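(* Let $I\subset\mathbb R$ be an open interval and let $w$ be a translationally invariant real solution, $w(t,\bar t)=w(x)$ for $t=x+iy\in I\times i\mathbb R$, of the Tzitzéica equation $$w_{t\bar t}=e^w-e^{-2w}.$$ Then $w$ gives rise to a hyperbolic affine sphere $f:I\times i\mathbb R\to\mathbb R^3$ (see context) which is equiaffinely equivalent to an affine sphere whose slice curve is a circle, a hyperbola, or a parabola.
   Context: Conventions: $t=x+iy$, $\partial_t=\frac12(\partial_x-i\partial_y)$. A hyperbolic affine sphere (centred at the origin) is a locally strongly convex immersed surface in $\mathbb R^3$ whose Blaschke affine normal, oriented so that the affine metric is positive definite, is a positive constant multiple of the position vector. The affine sphere to which $w$ gives rise (the paper's fixed normalization of the loop parameter, $\lambda=-i$ in the Delaunay-type potential) is the one, unique up to $\mathrm{SL}_3\mathbb R$, with affine metric $h(\partial_t,\partial_t)=h(\partial_{\bar t},\partial_{\bar t})=0$, $h(\partial_t,\partial_{\bar t})=e^w$ and structure equations $$f_{tt}=w_tf_t-e^{-w}f_{\bar t},\qquad f_{\bar t\bar t}=-e^{-w}f_t+w_{\bar t}f_{\bar t},\qquad f_{t\bar t}=e^wf .$$ Equivalently, $f=TF(0,1,0)^t$ up to $\mathrm{SL}_3\mathbb R$, where $T=\frac1{\sqrt3}\begin{pmatrix}1&1&1\\\omega&1&\omega^2\\\omega^2&1&\omega\end{pmatrix}$, $\omega=e^{2\pi i/3}$, and $$F^{-1}dF=\begin{pmatrix}\frac{w_t}2&-e^{w/2}&0\\0&0&-e^{w/2}\\-e^{-w}&0&-\frac{w_t}2\end{pmatrix}dt+\begin{pmatrix}-\frac{w_{\bar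 t}}2&0&-e^{-w}\\-e^{w/2}&0&0\\0&-e^{w/2}&\frac{w_{\bar t}}2\end{pmatrix}d\bar t,$$ with $F=I_3$ at a base point on $I\times\{0\}$. Equiaffinely equivalent means related by an element of $\mathrm{SL}_3\mathbb R$. The slice curve of $f$ (at $x$) is the curve $y\mapsto f(x+iy)$ with $x$ fixed; it lies in a plane, and "is a hyperbola" means that it is a branch of a hyperbola. *)

theory Defs
  imports "HOL-Analysis.Analysis"
begin

text \<open>
  The parameter plane is the type \<^typ>\<open>complex\<close>, with \<open>t = x + \<i> y\<close>. Real tangent vectors are
  complex numbers, so \<open>1\<close> and \<open>\<i>\<close> stand for the coordinate fields along \<open>x\<close> and \<open>y\<close>.
\<close>

definition dirder :: "complex \<Rightarrow> (complex \<Rightarrow> 'a::real_normed_vector) \<Rightarrow> complex \<Rightarrow> 'a" where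
  "dirder v f t = frechet_derivative f (at t) v"

text \<open>Meant for open sets only, where it is the usual notion.\<close>

primrec Ck_on :: "nat \<Rightarrow> complex set \<Rightarrow> (complex \<Rightarrow> 'a::real_normed_vector) \<Rightarrow> bool" where
  "Ck_on 0 S f \<longleftrightarrow> continuous_on S f"
| "Ck_on (Suc k) S f \<longleftrightarrow>
     f differentiable_on S \<and> Ck_on k S (dirder 1 f) \<and> Ck_on k S (dirder \<i> f)"

definition smooth_on :: "complex set \<Rightarrow> (complex \<Rightarrow> 'a::real_normed_vector) \<Rightarrow> bool" where
  "smooth_on S f \<longleftrightarrow> (\<forall>k. Ck_on k S f)"

definition wirt :: "(complex \<Rightarrow> complex) \<Rightarrow> complex \<Rightarrow> complex" where
  "wirt g t = (dirder 1 g t - \<i> * dirder \<i> g t) / 2"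

definition wirt_bar :: "(complex \<Rightarrow> complex) \<Rightarrow> complex \<Rightarrow> complex" where
  "wirt_bar g t = (dirder 1 g t + \<i> * dirder \<i> g t) / 2"

definition tzitzeica_solution :: "complex set \<Rightarrow> (complex \<Rightarrow> real) \<Rightarrow> bool" where
  "tzitzeica_solution S u \<longleftrightarrow> Ck_on 2 S u \<and>
     (\<forall>t\<in>S. wirt_bar (wirt (\<lambda>s. complex_of_real (u s))) t
            = complex_of_real (exp (u t) - exp (- 2 * u t)))"

definition strip :: "real set \<Rightarrow> complex set" where
  "strip I = {t. Re t \<in> I}"


definition tangent_plane :: "(complex \<Rightarrow> real^3) \<Rightarrow> complex \<Rightarrow> (real^3) set" where
  "tangent_plane f t = range (\<lambda>v. dirder v f t)"

definition immersion_on :: "complex set \<Rightarrow> (complex \<Rightarrow> real^3) \<Rightarrow> bool" where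
  "immersion_on S f \<longleftrightarrow> smooth_on S f \<and> (\<forall>t\<in>S. inj (\<lambda>v. dirder v f t))"

text \<open>
  \<open>\<xi>\<close> is a Blaschke affine normal of \<open>f\<close> and \<open>h\<close> the corresponding affine metric: the field \<open>\<xi>\<close> is
  transversal; the Gauss formula holds, its transversal part being \<open>h\<close>; the derivative of \<open>\<xi>\<close> is
  tangential; and the area form induced by \<open>\<xi>\<close> agrees, up to orientation, with the area form
  of \<open>h\<close>. For nondegenerate \<open>f\<close> these conditions determine \<open>(\<xi>, h)\<close> up to a common sign; a definite
  \<open>h\<close> means that \<open>f\<close> is locally strongly convex, and then positivity of \<open>h\<close> fixes that sign.
\<close>

definition blaschke_structure ::
  "complex set \<Rightarrow> (complex \<Rightarrow> real^3) \<Rightarrow> (complex \<Rightarrow> real^3)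
     \<Rightarrow> (complex \<Rightarrow> complex \<Rightarrow> complex \<Rightarrow> real) \<Rightarrow> bool" where
  "blaschke_structure S f \<xi> h \<longleftrightarrow>
     immersion_on S f \<and> smooth_on S \<xi> \<and>
     (\<forall>t\<in>S. \<xi> t \<notin> tangent_plane f t \<and>
        (\<forall>u v. dirder u (dirder v f) t - h t u v *\<^sub>R \<xi> t \<in> tangent_plane f t) \<and>
        (\<forall>v. dirder v \<xi> t \<in> tangent_plane f t) \<and>
        \<bar>det (vector [dirder 1 f t, dirder \<i> f t, \<xi> t] :: real^3^3)\<bar>
          = sqrt \<bar>h t 1 1 * h t \<i> \<i> - h t 1 \<i> * h t \<i> 1\<bar>)"

text \<open>Hyperbolic affine sphere centred at the origin, together with its affine metric \<open>h\<close>.\<close>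

definition hyperbolic_affine_sphere_with ::
  "complex set \<Rightarrow> (complex \<Rightarrow> real^3) \<Rightarrow> (complex \<Rightarrow> complex \<Rightarrow> complex \<Rightarrow> real) \<Rightarrow> bool" where
  "hyperbolic_affine_sphere_with S f h \<longleftrightarrow>
     (\<exists>\<xi>. blaschke_structure S f \<xi> h \<and>
          (\<forall>t\<in>S. \<forall>v. v \<noteq> 0 \<longrightarrow> h t v v > 0) \<and>
          (\<exists>c>0. \<forall>t\<in>S. \<xi> t = c *\<^sub>R f t))"

definition hyperbolic_affine_sphere :: "complex set \<Rightarrow> (complex \<Rightarrow> real^3) \<Rightarrow> bool" where
  "hyperbolic_affine_sphere S f \<longleftrightarrow> (\<exists>h. hyperbolic_affine_sphere_with S f h)"

text \<open>
  Complex bilinear extension of a real bilinear form on the tangent plane: the pair \<open>(a, b)\<close> of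
  complex numbers is the complexified tangent vector with components \<open>a\<close> along \<open>x\<close> and \<open>b\<close> along \<open>y\<close>.
\<close>

definition bilin_ext ::
  "(complex \<Rightarrow> complex \<Rightarrow> real) \<Rightarrow> complex \<times> complex \<Rightarrow> complex \<times> complex \<Rightarrow> complex" where
  "bilin_ext B p q =
     fst p * fst q * of_real (B 1 1) + fst p * snd q * of_real (B 1 \<i>) +
     snd p * fst q * of_real (B \<i> 1) + snd p * snd q * of_real (B \<i> \<i>)"

definition del_t :: "complex \<times> complex" where
  "del_t = (1/2, - \<i>/2)"

definition del_tbar :: "complex \<times> complex" where
  "del_tbar = (1/2, \<i>/2)"

text \<open>The structure equations for complex-valued \<open>\<phi>\<close>; they are imposed on each component of \<open>f\<close>.\<close>

definition structure_equations ::
  "complex set \<Rightarrow> (complex \<Rightarrow> real) \<Rightarrow> (complex \<Rightarrow> complex) \<Rightarrow> bool" where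
  "structure_equations S u \<phi> \<longleftrightarrow>
     (let U = (\<lambda>s. complex_of_real (u s)) in
      \<forall>t\<in>S.
        wirt (wirt \<phi>) t = wirt U t * wirt \<phi> t - exp (- U t) * wirt_bar \<phi> t \<and>
        wirt_bar (wirt_bar \<phi>) t = - exp (- U t) * wirt \<phi> t + wirt_bar U t * wirt_bar \<phi> t \<and>
        wirt_bar (wirt \<phi>) t = exp (U t) * \<phi> t)"

text \<open>
  The sign of \<open>det (f\<^sub>x, f\<^sub>y, f)\<close> is left open, so with \<open>f\<close> also \<open>- f\<close> qualifies. Since \<open>- I\<close> has
  determinant \<open>-1\<close> in dimension three, uniqueness up to \<open>SL\<^sub>3\<close> holds once that sign is fixed.
\<close>

definition gives_rise_to :: "complex set \<Rightarrow> (complex \<Rightarrow> real) \<Rightarrow> (complex \<Rightarrow> real^3) \<Rightarrow> bool" where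
  "gives_rise_to S u f \<longleftrightarrow>
     (\<exists>h. hyperbolic_affine_sphere_with S f h \<and>
        (\<forall>t\<in>S. bilin_ext (h t) del_t del_t = 0 \<and>
                bilin_ext (h t) del_tbar del_tbar = 0 \<and>
                bilin_ext (h t) del_t del_tbar = of_real (exp (u t)))) \<and>
     (\<forall>j. structure_equations S u (\<lambda>s. complex_of_real (f s $ j)))"

definition equiaffinely_equivalent ::
  "complex set \<Rightarrow> (complex \<Rightarrow> real^3) \<Rightarrow> (complex \<Rightarrow> real^3) \<Rightarrow> bool" where
  "equiaffinely_equivalent S f g \<longleftrightarrow>
     (\<exists>A :: real^3^3. det A = 1 \<and> (\<forall>t\<in>S. g t = A *v f t))"


definition slice_curve :: "(complex \<Rightarrow> real^3) \<Rightarrow> real \<Rightarrow> (real^3) set" where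
  "slice_curve f x = range (\<lambda>y. f (Complex x y))"

definition orthonormal_pair :: "real^3 \<Rightarrow> real^3 \<Rightarrow> bool" where
  "orthonormal_pair u v \<longleftrightarrow> norm u = 1 \<and> norm v = 1 \<and> u \<bullet> v = 0"

definition is_circle :: "(real^3) set \<Rightarrow> bool" where
  "is_circle C \<longleftrightarrow> (\<exists>p u v r. orthonormal_pair u v \<and> r > 0 \<and>
     C = {p + a *\<^sub>R u + b *\<^sub>R v | a b. a\<^sup>2 + b\<^sup>2 = r\<^sup>2})"

definition is_hyperbola_branch :: "(real^3) set \<Rightarrow> bool" where
  "is_hyperbola_branch C \<longleftrightarrow> (\<exists>p u v \<alpha> \<beta>. orthonormal_pair u v \<and> \<alpha> > 0 \<and> \<beta> > 0 \<and>
     C = {p + a *\<^sub>R u + b *\<^sub>R v | a b. a\<^sup>2 / \<alpha>\<^sup>2 - b\<^sup>2 / \<beta>\<^sup>2 = 1 \<and> a > 0})"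

definition is_parabola :: "(real^3) set \<Rightarrow> bool" where
  "is_parabola C \<longleftrightarrow> (\<exists>p u v k. orthonormal_pair u v \<and> k > 0 \<and>
     C = {p + a *\<^sub>R u + b *\<^sub>R v | a b. b = k * a\<^sup>2})"

end

theory Submission
  imports Defs
begin

text \<open>
  Write \<open>a = w'/2 + e\<^sup>-\<^sup>w\<close> and \<open>b = w'/2 - e\<^sup>-\<^sup>w\<close>. Separating real and imaginary parts, the structure
  equations for a profile \<open>w = w(x)\<close> become the real linear system
  \<open>f\<^sub>x\<^sub>x = b f\<^sub>x + 2 e\<^sup>w f\<close>, \<open>f\<^sub>x\<^sub>y = a f\<^sub>y\<close>, \<open>f\<^sub>y\<^sub>y = 2 e\<^sup>w f - b f\<^sub>x\<close>.
  The Tzitzeica equation becomes \<open>a' = 2 e\<^sup>w + a b - a\<^sup>2\<close>, \<open>b' = 2 e\<^sup>w + a b - b\<^sup>2\<close>, and hence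
  \<open>C = 2 e\<^sup>w - a b\<close> is a first integral. Along a slice, \<open>f\<^sub>y\<^sub>y\<^sub>y = C f\<^sub>y\<close>, and \<open>f\<^sub>x\<^sub>y = a f\<^sub>y\<close> says that
  in \<open>x\<close> the vector \<open>f\<^sub>y\<close> is only rescaled. So the sign of \<open>C\<close>, the same for all slices, decides
  between ellipse (\<open>C < 0\<close>), hyperbola (\<open>C > 0\<close>) and parabola (\<open>C = 0\<close>).
  
  This is made explicit. With \<open>P' = e\<^sup>-\<^sup>w\<close>, the function \<open>m = e\<^sup>w\<^sup>/\<^sup>2\<^sup>+\<^sup>P\<close> satisfies \<open>m' = a m\<close>, and
  \<open>m(x) U(y) + K(x)\<close> solves the system as soon as \<open>U'' = C U + Z\<close> with a constant vector \<open>Z\<close> and \<open>K\<close>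
  solves two ordinary equations (\<open>moving_frame_separated\<close>). For \<open>C \<noteq> 0\<close> one takes \<open>U = (cos k y, sin k y, 0)\<close>
  or \<open>U = (cosh k y, sinh k y, 0)\<close> with \<open>k\<^sup>2 = \<bar>C\<bar>\<close> and \<open>K\<close> a multiple of \<open>(0, 0, b e\<^sup>-\<^sup>2\<^sup>P)\<close>; for \<open>C = 0\<close> one
  takes \<open>U = (y\<^sup>2/2, y, 0)\<close>, and \<open>K\<close> acquires a first component. In these coordinates the slices are Euclidean
  circles, branches of equilateral hyperbolas and parabolas (\<open>conic_model\<close>).
  
  A solution of the system with \<open>\<bar>det (f\<^sub>x, f\<^sub>y, f)\<bar> = 2 e\<^sup>w\<close> is exactly an affine sphere to which \<open>w\<close> gives
  rise (\<open>gives_rise_to_of_moving_frame\<close>, \<open>moving_frame_of_gives_rise_to\<close>); a multiple of the third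
  coordinate achieves this normalization in the model. Finally the system is of finite type: \<open>f\<close> is determined by
  \<open>(f, f\<^sub>x, f\<^sub>y)\<close> at one point (\<open>moving_frame_zero\<close>). The linear map that matches the frames of two
  affine spheres at a point therefore matches them everywhere, and its determinant is \<open>\<plusminus>1\<close> because both
  frames have the same volume (\<open>gives_rise_to_unique\<close>). Hence every \<open>f\<close> is equiaffinely equivalent to the
  model or to its reflection \<open>- g\<close>, whose slices are conics of the same kind.
\<close>

section \<open>Calculus in the parameter plane\<close>

definition has_partials ::
    "(complex \<Rightarrow> 'a::real_normed_vector) \<Rightarrow> 'a \<Rightarrow> 'a \<Rightarrow> complex \<Rightarrow> bool" where
  "has_partials f p q t \<longleftrightarrow> (f has_derivative (\<lambda>v. Re v *\<^sub>R p + Im v *\<^sub>R q)) (at t)"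

lemma has_partials_dirder:
  assumes "has_partials f p q t"
  shows "dirder v f t = Re v *\<^sub>R p + Im v *\<^sub>R q"
  using frechet_derivative_at[OF assms[unfolded has_partials_def]]
  unfolding dirder_def by metis

lemma has_partials_dirder_1: "has_partials f p q t \<Longrightarrow> dirder 1 f t = p"
  and has_partials_dirder_ii: "has_partials f p q t \<Longrightarrow> dirder \<i> f t = q"
  by (simp_all add: has_partials_dirder)

lemma has_partials_differentiable: "has_partials f p q t \<Longrightarrow> f differentiable at t"
  unfolding has_partials_def differentiable_def by blast

lemma differentiable_has_partials:
  assumes "f differentiable at t"
  shows "has_partials f (dirder 1 f t) (dirder \<i> f t) t"
proof -
  let ?D = "frechet_derivative f (at t)"
  have D: "(f has_derivative ?D) (at t)"
    using assms frechet_derivative_works by blast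
  then interpret linear ?D by (rule has_derivative_linear)
  have "?D v = Re v *\<^sub>R ?D 1 + Im v *\<^sub>R ?D \<i>" for v
  proof -
    have "v = Re v *\<^sub>R 1 + Im v *\<^sub>R \<i>" by (simp add: complex_eq_iff)
    then have "?D v = ?D (Re v *\<^sub>R 1 + Im v *\<^sub>R \<i>)" by simp
    then show ?thesis by (simp add: add scaleR)
  qed
  then show ?thesis
    using D unfolding has_partials_def dirder_def by (metis (no_types, lifting) ext)
qed

lemma has_partials_cong:
  assumes "has_partials f p q t" "open S" "t \<in> S" "\<And>s. s \<in> S \<Longrightarrow> f s = g s"
  shows "has_partials g p q t"
  using assms unfolding has_partials_def by (blast intro: has_derivative_transform_within_open)

lemma has_partials_const: "has_partials (\<lambda>s. c) 0 0 t"
  by (simp add: has_partials_def)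

lemma has_partials_add:
  assumes "has_partials f p q t" "has_partials g p' q' t"
  shows "has_partials (\<lambda>s. f s + g s) (p + p') (q + q') t"
  using has_derivative_add[OF assms[unfolded has_partials_def]]
  by (simp add: has_partials_def algebra_simps)

lemma has_partials_linear:
  assumes "bounded_linear T" "has_partials f p q t"
  shows "has_partials (\<lambda>s. T (f s)) (T p) (T q) t"
proof -
  interpret bounded_linear T by fact
  show ?thesis
    using bounded_linear.has_derivative[OF assms(1) assms(2)[unfolded has_partials_def]]
    by (simp add: has_partials_def add scaleR)
qed

lemma has_partials_diff:
  assumes "has_partials f p q t" "has_partials g p' q' t"
  shows "has_partials (\<lambda>s. f s - g s) (p - p') (q - q') t"
  using has_derivative_diff[OF assms[unfolded has_partials_def]]
  by (simp add: has_partials_def algebra_simps)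

lemma has_partials_scaleR:
  assumes "has_partials r p q t" "has_partials f p' q' t"
  shows "has_partials (\<lambda>s. r s *\<^sub>R f s) (r t *\<^sub>R p' + p *\<^sub>R f t) (r t *\<^sub>R q' + q *\<^sub>R f t) t"
  using has_derivative_scaleR[OF assms[unfolded has_partials_def]]
  by (simp add: has_partials_def algebra_simps)

lemma has_partials_exp:
  assumes "has_partials u p q t"
  shows "has_partials (\<lambda>s. exp (u s :: real)) (exp (u t) *\<^sub>R p) (exp (u t) *\<^sub>R q) t"
  using has_derivative_exp[OF assms[unfolded has_partials_def]]
  by (simp add: has_partials_def algebra_simps)

lemma has_partials_Re:
  assumes "(h has_vector_derivative d) (at (Re t))"
  shows "has_partials (\<lambda>s. h (Re s)) d 0 t"
  using has_derivative_compose[OF has_derivative_Re[OF has_derivative_ident], of h _ t]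
    assms by (simp add: has_partials_def has_vector_derivative_def)

lemma has_partials_Im:
  assumes "(h has_vector_derivative d) (at (Im t))"
  shows "has_partials (\<lambda>s. h (Im s)) 0 d t"
  using has_derivative_compose[OF has_derivative_Im[OF has_derivative_ident], of h _ t]
    assms by (simp add: has_partials_def has_vector_derivative_def)

lemma Ck_on_cong:
  assumes "open S" "\<And>t. t \<in> S \<Longrightarrow> f t = g t" "Ck_on k S f"
  shows "Ck_on k S g"
  using assms(2,3)
proof (induction k arbitrary: f g)
  case 0
  then show ?case by (simp cong: continuous_on_cong)
next
  case (Suc k)
  have P: "has_partials f (dirder 1 f t) (dirder \<i> f t) t" if "t \<in> S" for t
    using Suc.prems that \<open>open S\<close>
    by (auto intro!: differentiable_has_partials simp: differentiable_on_eq_differentiable_at)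
  have Q: "has_partials g (dirder 1 f t) (dirder \<i> f t) t" if "t \<in> S" for t
    using has_partials_cong[OF P[OF that] \<open>open S\<close> that] Suc.prems by blast
  have "g differentiable_on S"
    using Q \<open>open S\<close>
    by (auto simp: differentiable_on_eq_differentiable_at intro: has_partials_differentiable)
  moreover have "Ck_on k S (dirder 1 g)"
    by (rule Suc.IH[of "dirder 1 f"]) (use Suc.prems has_partials_dirder_1[OF Q] in simp_all)
  moreover have "Ck_on k S (dirder \<i> g)"
    by (rule Suc.IH[of "dirder \<i> f"]) (use Suc.prems has_partials_dirder_ii[OF Q] in simp_all)
  ultimately show ?case by simp
qed

text \<open>
  The introduction rule that makes induction on the order of smoothness work: it asks for the partial
  derivatives on \<open>S\<close> only, so that any formula valid there can be used for them.
\<close>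

lemma Ck_on_SucI:
  assumes "open S" "\<And>t. t \<in> S \<Longrightarrow> has_partials f (p t) (q t) t" "Ck_on k S p" "Ck_on k S q"
  shows "Ck_on (Suc k) S f"
proof -
  have "Ck_on k S (dirder 1 f)"
    by (rule Ck_on_cong[OF \<open>open S\<close> _ assms(3)]) (simp add: has_partials_dirder_1[OF assms(2)])
  moreover have "Ck_on k S (dirder \<i> f)"
    by (rule Ck_on_cong[OF \<open>open S\<close> _ assms(4)]) (simp add: has_partials_dirder_ii[OF assms(2)])
  ultimately show ?thesis
    using assms(1,2)
    by (auto simp: differentiable_on_eq_differentiable_at intro: has_partials_differentiable)
qed

lemma Ck_on_Suc_has_partials:
  assumes "open S" "Ck_on (Suc k) S f" "t \<in> S"
  shows "has_partials f (dirder 1 f t) (dirder \<i> f t) t"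
  using assms by (auto intro!: differentiable_has_partials simp: differentiable_on_eq_differentiable_at)

lemma Ck_on_lower: "Ck_on (Suc k) S f \<Longrightarrow> Ck_on k S f"
proof (induction k arbitrary: f)
  case 0
  then show ?case by (simp add: differentiable_imp_continuous_on)
next
  case (Suc k)
  have "Ck_on k S (dirder 1 f)" "Ck_on k S (dirder \<i> f)"
    using Suc.prems by (intro Suc.IH; simp)+
  with Suc.prems show ?case by simp
qed

lemma Ck_on_const: "open S \<Longrightarrow> Ck_on k S (\<lambda>s. c)"
proof (induction k arbitrary: c)
  case (Suc k)
  then show ?case
    by (intro Ck_on_SucI[where p = "\<lambda>t. 0" and q = "\<lambda>t. 0"]) (auto intro: has_partials_const)
qed simp

lemma Ck_on_add:
  assumes "open S" "Ck_on k S f" "Ck_on k S g"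
  shows "Ck_on k S (\<lambda>s. f s + g s)"
  using assms(2,3)
proof (induction k arbitrary: f g)
  case (Suc k)
  show ?case
  proof (rule Ck_on_SucI[OF \<open>open S\<close> has_partials_add])
    fix t assume "t \<in> S"
    then show "has_partials f (dirder 1 f t) (dirder \<i> f t) t"
      "has_partials g (dirder 1 g t) (dirder \<i> g t) t"
      using Suc.prems Ck_on_Suc_has_partials[OF \<open>open S\<close>] by blast+
  qed (use Suc in auto)
qed (simp add: continuous_on_add)

lemma Ck_on_scaleR:
  assumes "open S" "Ck_on k S r" "Ck_on k S f"
  shows "Ck_on k S (\<lambda>s. r s *\<^sub>R f s)"
  using assms(2,3)
proof (induction k arbitrary: r f)
  case (Suc k)
  have r: "Ck_on k S r" and f: "Ck_on k S f" using Suc.prems by (simp_all only: Ck_on_lower)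
  show ?case
  proof (rule Ck_on_SucI[OF \<open>open S\<close> has_partials_scaleR])
    fix t assume "t \<in> S"
    then show "has_partials r (dirder 1 r t) (dirder \<i> r t) t"
      "has_partials f (dirder 1 f t) (dirder \<i> f t) t"
      using Suc.prems Ck_on_Suc_has_partials[OF \<open>open S\<close>] by blast+
  qed (use Suc r f in \<open>auto intro!: Ck_on_add[OF \<open>open S\<close>]\<close>)
qed (simp add: continuous_on_scaleR)

lemma Ck_on_exp:
  assumes "open S" "Ck_on k S u"
  shows "Ck_on k S (\<lambda>s. exp (u s :: real))"
  using assms(2)
proof (induction k)
  case (Suc k)
  show ?case
  proof (rule Ck_on_SucI[OF \<open>open S\<close> has_partials_exp])
    fix t assume "t \<in> S"
    then show "has_partials u (dirder 1 u t) (dirder \<i> u t) t"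
      using Suc.prems Ck_on_Suc_has_partials[OF \<open>open S\<close>] by blast
  qed (use Suc Ck_on_lower[OF Suc.prems] in
      \<open>auto intro!: Ck_on_scaleR[OF \<open>open S\<close>] simp del: real_scaleR_def\<close>)
qed (simp add: continuous_on_exp)

section \<open>The structure equations in real form\<close>

lemma open_strip: "open I \<Longrightarrow> open (strip I)"
  using continuous_open_vimage[of I Re]
  by (simp add: strip_def vimage_def continuous_on_Re)

lemma has_partials_restrict_real:
  assumes "has_partials h p q (of_real x)"
  shows "((\<lambda>s. h (of_real s)) has_vector_derivative p) (at x)"
proof -
  have "((\<lambda>s. complex_of_real s) has_derivative (\<lambda>s. complex_of_real s)) (at x)"
    by (intro derivative_eq_intros) auto
  from has_derivative_compose[OF this assms[unfolded has_partials_def]]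
  show ?thesis by (simp add: has_vector_derivative_def)
qed

lemma has_partials_nth:
  fixes f :: "complex \<Rightarrow> real^'n"
  shows "has_partials f p q t \<Longrightarrow> has_partials (\<lambda>s. f s $ j) (p $ j) (q $ j) t"
  by (rule has_partials_linear[OF bounded_linear_vec_nth])

lemma wirtinger_of_partials:
  fixes \<phi> :: "complex \<Rightarrow> real"
  defines "\<Phi> \<equiv> \<lambda>s. complex_of_real (\<phi> s)"
  assumes S: "open S" "t \<in> S"
    and 1: "\<And>s. s \<in> S \<Longrightarrow> has_partials \<phi> (p s) (q s) s"
    and 2: "has_partials p pp pq t" "has_partials q qp qq t"
  shows "wirt \<Phi> t = Complex (p t / 2) (- q t / 2)"
    and "wirt_bar \<Phi> t = Complex (p t / 2) (q t / 2)"
    and "wirt (wirt \<Phi>) t = Complex ((pp - qq) / 4) (- (qp + pq) / 4)"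
    and "wirt_bar (wirt_bar \<Phi>) t = Complex ((pp - qq) / 4) ((qp + pq) / 4)"
    and "wirt_bar (wirt \<Phi>) t = Complex ((pp + qq) / 4) ((pq - qp) / 4)"
proof -
  have \<Phi>: "has_partials \<Phi> (of_real (p s)) (of_real (q s)) s" if "s \<in> S" for s
    unfolding \<Phi>_def by (rule has_partials_linear[OF bounded_linear_of_real 1[OF that]])
  have w: "wirt \<Phi> s = of_real (p s) / 2 - \<i> * (of_real (q s) / 2)" if "s \<in> S" for s
    using \<Phi>[OF that] by (simp add: wirt_def has_partials_dirder diff_divide_distrib)
  have wb: "wirt_bar \<Phi> s = of_real (p s) / 2 + \<i> * (of_real (q s) / 2)" if "s \<in> S" for s
    using \<Phi>[OF that] by (simp add: wirt_bar_def has_partials_dirder add_divide_distrib)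
  have lin: "bounded_linear (\<lambda>r. complex_of_real r / 2)"
      "bounded_linear (\<lambda>r. \<i> * (complex_of_real r / 2))"
    by (rule bounded_linear_compose[OF bounded_linear_divide bounded_linear_of_real]
        bounded_linear_compose[OF bounded_linear_mult_right
          bounded_linear_compose[OF bounded_linear_divide bounded_linear_of_real]])+
  have P: "has_partials (\<lambda>s. complex_of_real (p s) / 2) (of_real pp / 2) (of_real pq / 2) t"
    "has_partials (\<lambda>s. \<i> * (complex_of_real (q s) / 2)) (\<i> * (of_real qp / 2)) (\<i> * (of_real qq / 2)) t"
    by (rule has_partials_linear[OF lin(1) 2(1)] has_partials_linear[OF lin(2) 2(2)])+
  have W: "has_partials (wirt \<Phi>) (of_real pp / 2 - \<i> * (of_real qp / 2))
      (of_real pq / 2 - \<i> * (of_real qq / 2)) t"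
    by (rule has_partials_cong[OF has_partials_diff[OF P] S]) (simp add: w)
  have Wb: "has_partials (wirt_bar \<Phi>) (of_real pp / 2 + \<i> * (of_real qp / 2))
      (of_real pq / 2 + \<i> * (of_real qq / 2)) t"
    by (rule has_partials_cong[OF has_partials_add[OF P] S]) (simp add: wb)
  show "wirt \<Phi> t = Complex (p t / 2) (- q t / 2)"
    "wirt_bar \<Phi> t = Complex (p t / 2) (q t / 2)"
    by (simp_all add: w[OF S(2)] wb[OF S(2)] complex_eq_iff)
  show "wirt (wirt \<Phi>) t = Complex ((pp - qq) / 4) (- (qp + pq) / 4)"
    "wirt_bar (wirt \<Phi>) t = Complex ((pp + qq) / 4) ((pq - qp) / 4)"
    using W by (simp_all add: wirt_def[of "wirt \<Phi>"] wirt_bar_def[of "wirt \<Phi>"]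
        has_partials_dirder complex_eq_iff field_simps)
  show "wirt_bar (wirt_bar \<Phi>) t = Complex ((pp - qq) / 4) ((qp + pq) / 4)"
    using Wb by (simp add: wirt_bar_def[of "wirt_bar \<Phi>"]
        has_partials_dirder complex_eq_iff field_simps)
qed

text \<open>
  The product of the two Wirtinger derivatives is a quarter of the Laplacian; on functions of \<open>x\<close> alone
  this is a quarter of the second derivative. So the Tzitzeica equation is \<open>w'' = 4 (e\<^sup>w - e\<^sup>-\<^sup>2\<^sup>w)\<close>; it is kept as a first-order system for \<open>(w, w')\<close>.
\<close>

lemma tzitzeica_profile_ode:
  assumes "open I" "tzitzeica_solution (strip I) (\<lambda>t. w (Re t))"
  obtains w1 where "\<And>x. x \<in> I \<Longrightarrow> (w has_real_derivative w1 x) (at x)"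
    "\<And>x. x \<in> I \<Longrightarrow> (w1 has_real_derivative 4 * (exp (w x) - exp (- 2 * w x))) (at x)"
proof -
  define u where "u = (\<lambda>t. w (Re t))"
  define w1 where "w1 = (\<lambda>x. dirder 1 u (of_real x))"
  define w2 where "w2 = (\<lambda>x. dirder 1 (dirder 1 u) (of_real x))"
  note S = open_strip[OF assms(1)]
  have C: "Ck_on (Suc (Suc 0)) (strip I) u"
    using assms(2) by (simp add: tzitzeica_solution_def u_def numeral_2_eq_2)
  have dw: "(w has_vector_derivative w1 x) (at x)" if "x \<in> I" for x
    using has_partials_restrict_real[OF Ck_on_Suc_has_partials[OF S C, of "of_real x"]] that
    by (simp add: strip_def u_def w1_def)
  have Pu: "has_partials u (w1 (Re t)) 0 t" if "t \<in> strip I" for t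
    using that dw unfolding u_def by (intro has_partials_Re) (simp add: strip_def)
  have C1: "Ck_on (Suc 0) (strip I) (dirder 1 u)"
    using C by simp
  have dw1: "(w1 has_vector_derivative w2 x) (at x)" if "x \<in> I" for x
    using has_partials_restrict_real[OF Ck_on_Suc_has_partials[OF S C1, of "of_real x"]] that
    by (simp add: strip_def w1_def w2_def)
  have "w2 x = 4 * (exp (w x) - exp (- 2 * w x))" if "x \<in> I" for x
  proof -
    have x: "of_real x \<in> strip I" using that by (simp add: strip_def)
    have "has_partials (\<lambda>t. w1 (Re t)) (w2 x) 0 (of_real x)"
      using dw1[OF that] by (intro has_partials_Re) simp
    from wirtinger_of_partials(5)[OF S x Pu this has_partials_const]
    have "wirt_bar (wirt (\<lambda>s. complex_of_real (u s))) (of_real x) = of_real (w2 x / 4)"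
      by (simp add: complex_eq_iff)
    moreover have "wirt_bar (wirt (\<lambda>s. complex_of_real (u s))) (of_real x)
        = of_real (exp (w x) - exp (- 2 * w x))"
      using assms(2) x unfolding tzitzeica_solution_def u_def by simp
    ultimately show ?thesis by (simp only: of_real_eq_iff)
  qed
  with dw dw1 show ?thesis
    by (intro that[of w1]) (simp_all add: has_real_derivative_iff_has_vector_derivative)
qed

locale tzitzeica_profile =
  fixes I :: "real set" and w w1 :: "real \<Rightarrow> real"
  assumes open_I: "open I" and interval_I: "is_interval I" and nonempty_I: "I \<noteq> {}"
    and dw: "x \<in> I \<Longrightarrow> (w has_real_derivative w1 x) (at x)"
    and dw1: "x \<in> I \<Longrightarrow> (w1 has_real_derivative 4 * (exp (w x) - exp (- 2 * w x))) (at x)"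
begin

abbreviation S :: "complex set" where "S \<equiv> strip I"

lemmas open_S = open_strip[OF open_I]

text \<open>
  The function \<open>a\<close> is the logarithmic derivative of \<open>f\<^sub>y\<close> along \<open>x\<close>; \<open>b\<close> is its conjugate under
  \<open>e\<^sup>-\<^sup>w \<mapsto> - e\<^sup>-\<^sup>w\<close>. In terms of both, the Tzitzeica equation becomes a pair of Riccati equations.
\<close>

definition a :: "real \<Rightarrow> real" where "a x = w1 x / 2 + exp (- w x)"
definition b :: "real \<Rightarrow> real" where "b x = w1 x / 2 - exp (- w x)"

text \<open>
  Bootstrapping: the equation expresses the derivatives of \<open>w\<close> and \<open>w'\<close> through \<open>w\<close> and \<open>w'\<close>,
  so a solution that is only twice differentiable is smooth.
\<close>

lemma smooth_profile: "Ck_on k S (\<lambda>t. w (Re t)) \<and> Ck_on k S (\<lambda>t. w1 (Re t))"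
proof (induction k)
  case 0
  have "continuous_on I w" "continuous_on I w1"
    using dw dw1 by (blast intro: DERIV_isCont continuous_at_imp_continuous_on)+
  then show ?case
    by (auto simp: strip_def intro!: continuous_on_compose2[of I _ _ Re] continuous_intros)
next
  case (Suc k)
  have P: "has_partials (\<lambda>t. w (Re t)) (w1 (Re t)) 0 t"
    "has_partials (\<lambda>t. w1 (Re t)) (4 *\<^sub>R (exp (w (Re t)) + (-1) *\<^sub>R exp ((-2) *\<^sub>R w (Re t)))) 0 t"
    if "t \<in> S" for t
    using that dw[of "Re t"] dw1[of "Re t"]
    by (auto intro!: has_partials_Re
        simp: strip_def has_real_derivative_iff_has_vector_derivative)
  have "Ck_on k S (\<lambda>t. 4 *\<^sub>R (exp (w (Re t)) + (-1) *\<^sub>R exp ((-2) *\<^sub>R w (Re t))))"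
    using Suc open_S by (intro Ck_on_scaleR Ck_on_const Ck_on_add Ck_on_exp) auto
  then show ?case
    using Suc Ck_on_SucI[OF open_S P(1)] Ck_on_SucI[OF open_S P(2)] Ck_on_const[OF open_S]
    by blast
qed

lemma smooth_coefficients:
  "Ck_on k S (\<lambda>t. a (Re t))" "Ck_on k S (\<lambda>t. b (Re t))" "Ck_on k S (\<lambda>t. exp (w (Re t)))"
proof -
  have "Ck_on k S (\<lambda>t. (1/2) *\<^sub>R w1 (Re t) + exp ((-1) *\<^sub>R w (Re t)))"
    "Ck_on k S (\<lambda>t. (1/2) *\<^sub>R w1 (Re t) + (-1) *\<^sub>R exp ((-1) *\<^sub>R w (Re t)))"
    using smooth_profile open_S
    by (intro Ck_on_scaleR Ck_on_const Ck_on_add Ck_on_exp; blast)+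
  then show "Ck_on k S (\<lambda>t. a (Re t))" "Ck_on k S (\<lambda>t. b (Re t))"
    by (simp_all add: a_def b_def)
  show "Ck_on k S (\<lambda>t. exp (w (Re t)))"
    using smooth_profile open_S by (intro Ck_on_exp) auto
qed

text \<open>
  The functions \<open>p\<close> and \<open>q\<close> stand for \<open>f\<^sub>x\<close> and \<open>f\<^sub>y\<close>. The second derivatives then become a linear
  first-order system for \<open>(f, p, q)\<close>; this closed form serves for regularity as well as for uniqueness.
\<close>

definition moving_frame ::
    "(complex \<Rightarrow> 'a::real_normed_vector) \<Rightarrow> (complex \<Rightarrow> 'a) \<Rightarrow> (complex \<Rightarrow> 'a) \<Rightarrow> bool" where
  "moving_frame f p q \<longleftrightarrow> (\<forall>t\<in>S.
     has_partials f (p t) (q t) t \<and>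
     has_partials p (b (Re t) *\<^sub>R p t + (2 * exp (w (Re t))) *\<^sub>R f t) (a (Re t) *\<^sub>R q t) t \<and>
     has_partials q (a (Re t) *\<^sub>R q t) ((2 * exp (w (Re t))) *\<^sub>R f t - b (Re t) *\<^sub>R p t) t)"

lemma moving_frameD:
  assumes "moving_frame f p q" "t \<in> S"
  shows "has_partials f (p t) (q t) t"
    "has_partials p (b (Re t) *\<^sub>R p t + (2 * exp (w (Re t))) *\<^sub>R f t) (a (Re t) *\<^sub>R q t) t"
    "has_partials q (a (Re t) *\<^sub>R q t) ((2 * exp (w (Re t))) *\<^sub>R f t - b (Re t) *\<^sub>R p t) t"
  using assms unfolding moving_frame_def by blast+

lemma moving_frame_smooth:
  assumes "moving_frame f p q"
  shows "smooth_on S f"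
proof -
  note D = moving_frameD[OF assms]
  have cont: "continuous_on S g" if "\<And>t. t \<in> S \<Longrightarrow> has_partials g (p' t) (q' t) t"
    for g :: "complex \<Rightarrow> 'a" and p' q'
    using that by (intro differentiable_imp_continuous_on)
      (auto simp: differentiable_on_def intro: differentiable_at_withinI has_partials_differentiable)
  have "Ck_on k S f \<and> Ck_on k S p \<and> Ck_on k S q" for k
  proof (induction k)
    case 0
    show ?case using cont[OF D(1)] cont[OF D(2)] cont[OF D(3)] by simp
  next
    case (Suc k)
    have *: "Ck_on k S (\<lambda>t. a (Re t) *\<^sub>R q t)" "Ck_on k S (\<lambda>t. b (Re t) *\<^sub>R p t)"
      "Ck_on k S (\<lambda>t. (2 * exp (w (Re t))) *\<^sub>R f t)"
      using Suc smooth_coefficients[of k] open_S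
        Ck_on_scaleR[OF open_S Ck_on_const[OF open_S, of k 2], of "\<lambda>t. exp (w (Re t))"]
      by (auto intro!: Ck_on_scaleR)
    have "Ck_on k S (\<lambda>t. (2 * exp (w (Re t))) *\<^sub>R f t + (-1) *\<^sub>R (b (Re t) *\<^sub>R p t))"
      by (rule Ck_on_add[OF open_S *(3) Ck_on_scaleR[OF open_S Ck_on_const[OF open_S] *(2)]])
    then have "Ck_on k S (\<lambda>t. (2 * exp (w (Re t))) *\<^sub>R f t - b (Re t) *\<^sub>R p t)" by simp
    then show ?case
      using Ck_on_SucI[OF open_S D(1)] Ck_on_SucI[OF open_S D(2) Ck_on_add[OF open_S *(2) *(3)] *(1)]
        Ck_on_SucI[OF open_S D(3) *(1)] Suc by blast
  qed
  then show ?thesis by (simp add: smooth_on_def)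
qed

text \<open>
  The symmetry of the mixed second derivatives is part of the equivalence: as \<open>\<phi>\<close> is real, it is the
  imaginary part of the third structure equation, the one that equates the mixed Wirtinger derivative
  of \<open>\<phi>\<close> with \<open>e\<^sup>w \<phi>\<close>.
\<close>

lemma structure_equations_real_form:
  fixes \<phi> :: "complex \<Rightarrow> real"
  assumes 1: "\<And>s. s \<in> S \<Longrightarrow> has_partials \<phi> (p s) (q s) s"
    and 2: "\<And>s. s \<in> S \<Longrightarrow> has_partials p (pp s) (pq s) s"
      "\<And>s. s \<in> S \<Longrightarrow> has_partials q (qp s) (qq s) s"
  shows "structure_equations S (\<lambda>t. w (Re t)) (\<lambda>s. complex_of_real (\<phi> s)) \<longleftrightarrow>
    (\<forall>t\<in>S. pp t = b (Re t) * p t + 2 * exp (w (Re t)) * \<phi> t \<and> pq t = a (Re t) * q t \<and>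
       qp t = a (Re t) * q t \<and> qq t = 2 * exp (w (Re t)) * \<phi> t - b (Re t) * p t)"
proof -
  have Pw: "has_partials (\<lambda>t. w (Re t)) (w1 (Re t)) 0 t" if "t \<in> S" for t
    using that dw[of "Re t"]
    by (auto intro!: has_partials_Re
        simp: strip_def has_real_derivative_iff_has_vector_derivative)
  have Pw1: "has_partials (\<lambda>t. w1 (Re t)) (4 * (exp (w (Re t)) - exp (- 2 * w (Re t)))) 0 t"
    if "t \<in> S" for t
    using that dw1[of "Re t"]
    by (auto intro!: has_partials_Re
        simp: strip_def has_real_derivative_iff_has_vector_derivative)
  have ex: "exp (complex_of_real r) = Complex (exp r) 0" "exp (- complex_of_real r) = Complex (exp (- r)) 0"
    "complex_of_real r = Complex r 0" for r
    by (simp_all add: exp_of_real complex_of_real_def[symmetric] flip: of_real_minus)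
  show ?thesis
    unfolding structure_equations_def Let_def
  proof (rule ball_cong[OF refl])
    fix t assume t: "t \<in> S"
    note W = wirtinger_of_partials[OF open_S t 1 2(1)[OF t] 2(2)[OF t]]
    note U = wirtinger_of_partials(1,2)[OF open_S t Pw Pw1[OF t] has_partials_const]
    show "(wirt (wirt (\<lambda>s. complex_of_real (\<phi> s))) t =
          wirt (\<lambda>s. complex_of_real (w (Re s))) t * wirt (\<lambda>s. complex_of_real (\<phi> s)) t -
          exp (- complex_of_real (w (Re t))) * wirt_bar (\<lambda>s. complex_of_real (\<phi> s)) t \<and>
          wirt_bar (wirt_bar (\<lambda>s. complex_of_real (\<phi> s))) t =
          - exp (- complex_of_real (w (Re t))) * wirt (\<lambda>s. complex_of_real (\<phi> s)) t +
          wirt_bar (\<lambda>s. complex_of_real (w (Re s))) t * wirt_bar (\<lambda>s. complex_of_real (\<phi> s)) t \<and>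
          wirt_bar (wirt (\<lambda>s. complex_of_real (\<phi> s))) t =
          exp (complex_of_real (w (Re t))) * complex_of_real (\<phi> t)) \<longleftrightarrow>
      (pp t = b (Re t) * p t + 2 * exp (w (Re t)) * \<phi> t \<and> pq t = a (Re t) * q t \<and>
       qp t = a (Re t) * q t \<and> qq t = 2 * exp (w (Re t)) * \<phi> t - b (Re t) * p t)"
      by (simp only: W U, simp only: ex(1,2), simp only: ex(3) a_def b_def)
        (simp add: complex_eq_iff field_simps, argo)
  qed
qed

lemma moving_frame_of_structure_equations:
  fixes f :: "complex \<Rightarrow> real^'n"
  assumes sm: "smooth_on S f"
    and eqs: "\<And>j. structure_equations S (\<lambda>t. w (Re t)) (\<lambda>s. complex_of_real (f s $ j))"
  shows "moving_frame f (dirder 1 f) (dirder \<i> f)"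
proof -
  have "Ck_on (Suc (Suc 0)) S f" using sm unfolding smooth_on_def by blast
  then have C: "Ck_on (Suc (Suc 0)) S f" "Ck_on (Suc 0) S (dirder 1 f)" "Ck_on (Suc 0) S (dirder \<i> f)"
    by auto
  note D = C[THEN Ck_on_Suc_has_partials[OF open_S]]
  note E = structure_equations_real_form[OF D[THEN has_partials_nth], THEN iffD1, OF _ _ _ eqs]
  show ?thesis
    unfolding moving_frame_def
  proof (intro ballI conjI)
    fix t assume t: "t \<in> S"
    have *: "dirder 1 (dirder 1 f) t = b (Re t) *\<^sub>R dirder 1 f t + (2 * exp (w (Re t))) *\<^sub>R f t"
      "dirder \<i> (dirder 1 f) t = a (Re t) *\<^sub>R dirder \<i> f t"
      "dirder 1 (dirder \<i> f) t = a (Re t) *\<^sub>R dirder \<i> f t"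
      "dirder \<i> (dirder \<i> f) t = (2 * exp (w (Re t))) *\<^sub>R f t - b (Re t) *\<^sub>R dirder 1 f t"
      using E t by (simp_all add: vec_eq_iff)
    show "has_partials f (dirder 1 f t) (dirder \<i> f t) t"
      "has_partials (dirder 1 f) (b (Re t) *\<^sub>R dirder 1 f t + (2 * exp (w (Re t))) *\<^sub>R f t)
        (a (Re t) *\<^sub>R dirder \<i> f t) t"
      "has_partials (dirder \<i> f) (a (Re t) *\<^sub>R dirder \<i> f t)
        ((2 * exp (w (Re t))) *\<^sub>R f t - b (Re t) *\<^sub>R dirder 1 f t) t"
      using D(1)[OF t] D(2)[OF t] D(3)[OF t] unfolding * by auto
  qed
qed

lemma structure_equations_of_moving_frame:
  fixes f :: "complex \<Rightarrow> real^'n"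
  assumes "moving_frame f p q"
  shows "structure_equations S (\<lambda>t. w (Re t)) (\<lambda>s. complex_of_real (f s $ j))"
  by (subst structure_equations_real_form[OF moving_frameD[OF assms, THEN has_partials_nth]]) auto

end

section \<open>Affine spheres as unimodular frames, and their uniqueness\<close>

lemma det_rows_independent:
  fixes x y z :: "real^3"
  assumes "det (vector [x, y, z] :: real^3^3) \<noteq> 0" "\<alpha> *\<^sub>R x + \<beta> *\<^sub>R y + \<gamma> *\<^sub>R z = 0"
  shows "\<alpha> = 0" "\<beta> = 0" "\<gamma> = 0"
proof -
  let ?c = "\<alpha> *\<^sub>R x + \<beta> *\<^sub>R y + \<gamma> *\<^sub>R z"
  have *: "\<alpha> * det (vector [x, y, z] :: real^3^3) = det (vector [?c, y, z] :: real^3^3)"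
    "\<beta> * det (vector [x, y, z] :: real^3^3) = det (vector [x, ?c, z] :: real^3^3)"
    "\<gamma> * det (vector [x, y, z] :: real^3^3) = det (vector [x, y, ?c] :: real^3^3)"
    by (simp_all add: det_3 vector_3 algebra_simps)
  show "\<alpha> = 0" "\<beta> = 0" "\<gamma> = 0"
    using *[unfolded assms(2)] assms(1) by (simp_all add: det_3[of "vector [0, y, z]"]
        det_3[of "vector [x, 0, z]"] det_3[of "vector [x, y, 0]"] vector_3)
qed

text \<open>
  A Gronwall estimate: the factor \<open>exp (- L s)\<close> turns the inequality into monotonicity.
\<close>

lemma vanishing_of_differential_inequality:
  fixes E :: "real \<Rightarrow> real"
  assumes der: "\<And>s. 0 \<le> s \<Longrightarrow> s \<le> 1 \<Longrightarrow> (E has_real_derivative E' s) (at s)"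
    and le: "\<And>s. 0 \<le> s \<Longrightarrow> s \<le> 1 \<Longrightarrow> E' s \<le> L * E s"
    and "E 0 = 0" "E 1 \<ge> 0"
  shows "E 1 = 0"
proof -
  have "E 1 * exp (- L * 1) \<le> E 0 * exp (- L * 0)"
  proof (rule DERIV_nonpos_imp_nonincreasing[of 0 1 "\<lambda>s. E s * exp (- L * s)"])
    fix s :: real assume s: "0 \<le> s" "s \<le> 1"
    have "((\<lambda>s. E s * exp (- L * s)) has_real_derivative (E' s - L * E s) * exp (- L * s)) (at s)"
      by (rule derivative_eq_intros der[OF s] refl | simp add: algebra_simps)+
    moreover have "(E' s - L * E s) * exp (- L * s) \<le> 0"
      using le[OF s] by (simp add: mult_nonpos_nonneg)
    ultimately show "\<exists>y. ((\<lambda>s. E s * exp (- L * s)) has_real_derivative y) (at s) \<and> y \<le> 0"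
      by blast
  qed simp
  then show ?thesis using assms(3,4) by (simp add: mult_le_0_iff)
qed

lemma has_partials_along_line:
  assumes "has_partials f p q (t0 + of_real s * v)"
  shows "((\<lambda>s. f (t0 + of_real s * v)) has_vector_derivative Re v *\<^sub>R p + Im v *\<^sub>R q) (at s)"
proof -
  have "((\<lambda>s. t0 + complex_of_real s * v) has_derivative (\<lambda>s. complex_of_real s * v)) (at s)"
    by (auto intro!: derivative_eq_intros)
  from has_derivative_compose[OF this assms[unfolded has_partials_def]]
  show ?thesis by (simp add: has_vector_derivative_def scaleR_add_right)
qed

context tzitzeica_profile
begin

text \<open>
  The affine normal is \<open>f\<close> itself and the affine metric is \<open>2 e\<^sup>w\<close> times the Euclidean one: the
  transversal parts of \<open>f\<^sub>x\<^sub>x\<close>, \<open>f\<^sub>x\<^sub>y\<close>, \<open>f\<^sub>y\<^sub>y\<close> are \<open>2 e\<^sup>w f\<close>, \<open>0\<close>, \<open>2 e\<^sup>w f\<close>, and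
  the condition on the determinant is the equality of the two area forms.
\<close>

lemma gives_rise_to_of_moving_frame:
  fixes f :: "complex \<Rightarrow> real^3"
  assumes mf: "moving_frame f p q"
    and det: "\<And>t. t \<in> S \<Longrightarrow> \<bar>det (vector [p t, q t, f t] :: real^3^3)\<bar> = 2 * exp (w (Re t))"
  shows "gives_rise_to S (\<lambda>t. w (Re t)) f"
proof -
  note D = moving_frameD[OF mf]
  define h where "h = (\<lambda>t u v. 2 * exp (w (Re t)) * (Re u * Re v + Im u * Im v))"
  have df: "dirder v f t = Re v *\<^sub>R p t + Im v *\<^sub>R q t" if "t \<in> S" for v t
    using has_partials_dirder[OF D(1)[OF that]] .
  have T: "x \<in> tangent_plane f t \<longleftrightarrow> (\<exists>v. x = Re v *\<^sub>R p t + Im v *\<^sub>R q t)" if "t \<in> S" for x t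
    using df[OF that] by (auto simp: tangent_plane_def)
  have ind: "v = 0 \<and> c = 0"
    if "t \<in> S" "Re v *\<^sub>R p t + Im v *\<^sub>R q t + c *\<^sub>R f t = 0" for v c t
  proof -
    have "det (vector [p t, q t, f t] :: real^3^3) \<noteq> 0" using det[OF that(1)] by auto
    from det_rows_independent[OF this that(2)] show ?thesis by (simp add: complex_eq_iff)
  qed
  have sm: "smooth_on S f" using moving_frame_smooth[OF mf] .
  have imm: "immersion_on S f"
    unfolding immersion_on_def
  proof (intro conjI sm ballI injI)
    fix t x y assume "t \<in> S" "dirder x f t = dirder y f t"
    then show "x = y"
      using ind[of t "x - y" 0] by (simp add: df algebra_simps)
  qed
  have nott: "f t \<notin> tangent_plane f t" if t: "t \<in> S" for t
  proof
    assume "f t \<in> tangent_plane f t"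
    then obtain v where "f t = Re v *\<^sub>R p t + Im v *\<^sub>R q t" using T[OF t] by blast
    then show False using ind[OF t, of v "-1"] by simp
  qed
  have gauss: "dirder u (dirder v f) t - h t u v *\<^sub>R f t \<in> tangent_plane f t" if t: "t \<in> S" for t u v
  proof -
    have "has_partials (\<lambda>s. Re v *\<^sub>R p s + Im v *\<^sub>R q s)
       (Re v *\<^sub>R (b (Re t) *\<^sub>R p t + (2 * exp (w (Re t))) *\<^sub>R f t) + Im v *\<^sub>R (a (Re t) *\<^sub>R q t))
       (Re v *\<^sub>R (a (Re t) *\<^sub>R q t) + Im v *\<^sub>R ((2 * exp (w (Re t))) *\<^sub>R f t - b (Re t) *\<^sub>R p t)) t"
      by (intro has_partials_add has_partials_linear[OF bounded_linear_scaleR_right] D[OF t])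
    from has_partials_dirder[OF has_partials_cong[OF this open_S t df[symmetric]]]
    have "dirder u (dirder v f) t - h t u v *\<^sub>R f t =
      (b (Re t) * (Re u * Re v - Im u * Im v)) *\<^sub>R p t + (a (Re t) * (Re u * Im v + Im u * Re v)) *\<^sub>R q t"
      by (simp add: h_def algebra_simps)
    then show ?thesis
      unfolding T[OF t] by (metis complex.sel)
  qed
  have "blaschke_structure S f f h"
    unfolding blaschke_structure_def
  proof (intro conjI imm sm ballI allI nott gauss)
    fix t v assume t: "t \<in> S"
    show "dirder v f t \<in> tangent_plane f t" by (simp add: tangent_plane_def)
    show "\<bar>det (vector [dirder 1 f t, dirder \<i> f t, f t] :: real^3^3)\<bar> =
        sqrt \<bar>h t 1 1 * h t \<i> \<i> - h t 1 \<i> * h t \<i> 1\<bar>"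
      using det[OF t] real_sqrt_mult_self[of "2 * exp (w (Re t))"]
      by (simp add: df[OF t] h_def real_sqrt_mult)
  qed
  moreover have "h t v v > 0" if "v \<noteq> 0" for t v
    using that by (simp add: h_def complex_eq_iff sum_squares_gt_zero_iff)
  ultimately have "hyperbolic_affine_sphere_with S f h"
    unfolding hyperbolic_affine_sphere_with_def
    by (intro exI[of _ f]) (auto intro: exI[of _ "1::real"])
  moreover have "bilin_ext (h t) del_t del_t = 0" "bilin_ext (h t) del_tbar del_tbar = 0"
    "bilin_ext (h t) del_t del_tbar = of_real (exp (w (Re t)))" for t
    by (simp_all add: bilin_ext_def h_def del_t_def del_tbar_def field_simps)
  ultimately show ?thesis
    unfolding gives_rise_to_def
    using structure_equations_of_moving_frame[OF mf] by blast
qed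

text \<open>
  The affine normal \<open>c f\<close> must be \<open>f\<close>. Indeed the trace of the Gauss formula is
  \<open>f\<^sub>x\<^sub>x + f\<^sub>y\<^sub>y = 4 e\<^sup>w c f\<close> modulo tangent vectors, while the structure equations give \<open>4 e\<^sup>w f\<close>,
  and \<open>f\<close> is transversal. With \<open>c = 1\<close> the equality of area forms fixes the volume of the frame.
\<close>

lemma moving_frame_of_gives_rise_to:
  assumes "gives_rise_to S (\<lambda>t. w (Re t)) f"
  shows "moving_frame f (dirder 1 f) (dirder \<i> f)"
    and "t \<in> S \<Longrightarrow>
      \<bar>det (vector [dirder 1 f t, dirder \<i> f t, f t] :: real^3^3)\<bar> = 2 * exp (w (Re t))"
proof -
  obtain h \<xi> c where bs: "blaschke_structure S f \<xi> h" and c: "c > 0" "\<And>t. t \<in> S \<Longrightarrow> \<xi> t = c *\<^sub>R f t"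
    and bil: "\<And>t. t \<in> S \<Longrightarrow> bilin_ext (h t) del_t del_t = 0"
      "\<And>t. t \<in> S \<Longrightarrow> bilin_ext (h t) del_t del_tbar = of_real (exp (w (Re t)))"
    using assms unfolding gives_rise_to_def hyperbolic_affine_sphere_with_def by blast
  have eqs: "structure_equations S (\<lambda>t. w (Re t)) (\<lambda>s. complex_of_real (f s $ j))" for j
    using assms unfolding gives_rise_to_def by blast
  show mf: "moving_frame f (dirder 1 f) (dirder \<i> f)"
    using bs eqs by (intro moving_frame_of_structure_equations)
      (auto simp: blaschke_structure_def immersion_on_def)
  note D = moving_frameD[OF mf]
  assume t: "t \<in> S"
  have h: "h t 1 1 = 2 * exp (w (Re t))" "h t \<i> \<i> = 2 * exp (w (Re t))" "h t 1 \<i> = 0" "h t \<i> 1 = 0"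
    using bil[OF t] by (simp_all add: bilin_ext_def del_t_def del_tbar_def complex_eq_iff)
  let ?T = "tangent_plane f t"
  have sub: "subspace ?T"
  proof -
    have "linear (\<lambda>v. dirder v f t)"
      unfolding dirder_def
      using linear_frechet_derivative[OF has_partials_differentiable[OF D(1)[OF t]]] .
    then show ?thesis
      unfolding tangent_plane_def using linear_subspace_image subspace_UNIV by blast
  qed
  have "dirder 1 (dirder 1 f) t - h t 1 1 *\<^sub>R \<xi> t \<in> ?T" "dirder \<i> (dirder \<i> f) t - h t \<i> \<i> *\<^sub>R \<xi> t \<in> ?T"
    using bs t unfolding blaschke_structure_def by blast+
  from subspace_add[OF sub this]
  have "(4 * exp (w (Re t)) * (1 - c)) *\<^sub>R f t \<in> ?T"
    by (simp add: has_partials_dirder_1[OF D(2)[OF t]] has_partials_dirder_ii[OF D(3)[OF t]]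
        h c t algebra_simps flip: scaleR_add_left)
  moreover have "f t \<notin> ?T"
    using bs t c subspace_scale[OF sub, of "f t" c] unfolding blaschke_structure_def by auto
  ultimately have "c = 1"
    using subspace_scale[OF sub, of _ "inverse (4 * exp (w (Re t)) * (1 - c))"]
    by (metis (no_types, opaque_lifting) exp_not_eq_zero mult_eq_0_iff right_inverse scaleR_one
        scaleR_scaleR left_inverse right_minus_eq zero_neq_numeral)
  moreover have "\<bar>det (vector [dirder 1 f t, dirder \<i> f t, \<xi> t] :: real^3^3)\<bar>
      = sqrt \<bar>h t 1 1 * h t \<i> \<i> - h t 1 \<i> * h t \<i> 1\<bar>"
    using bs t unfolding blaschke_structure_def by blast
  ultimately show "\<bar>det (vector [dirder 1 f t, dirder \<i> f t, f t] :: real^3^3)\<bar> = 2 * exp (w (Re t))"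
    using c(2)[OF t] real_sqrt_mult_self[of "2 * exp (w (Re t))"] by (simp add: h real_sqrt_mult)
qed

lemma moving_frame_linear:
  assumes "bounded_linear T" "moving_frame f p q"
  shows "moving_frame (\<lambda>t. T (f t)) (\<lambda>t. T (p t)) (\<lambda>t. T (q t))"
proof -
  interpret bounded_linear T by fact
  show ?thesis
    using moving_frameD[OF assms(2), THEN has_partials_linear[OF assms(1)]]
    by (simp add: moving_frame_def add diff scaleR)
qed

lemma moving_frame_diff:
  assumes "moving_frame f p q" "moving_frame f' p' q'"
  shows "moving_frame (\<lambda>t. f t - f' t) (\<lambda>t. p t - p' t) (\<lambda>t. q t - q' t)"
  unfolding moving_frame_def
proof (intro ballI conjI)
  fix t assume t: "t \<in> S"
  note D = moving_frameD[OF assms(1) t] and D' = moving_frameD[OF assms(2) t]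
  show "has_partials (\<lambda>t. f t - f' t) (p t - p' t) (q t - q' t) t"
    by (rule has_partials_diff[OF D(1) D'(1)])
  show "has_partials (\<lambda>t. p t - p' t)
      (b (Re t) *\<^sub>R (p t - p' t) + (2 * exp (w (Re t))) *\<^sub>R (f t - f' t)) (a (Re t) *\<^sub>R (q t - q' t)) t"
    using has_partials_diff[OF D(2) D'(2)] by (simp add: algebra_simps)
  show "has_partials (\<lambda>t. q t - q' t) (a (Re t) *\<^sub>R (q t - q' t))
      ((2 * exp (w (Re t))) *\<^sub>R (f t - f' t) - b (Re t) *\<^sub>R (p t - p' t)) t"
    using has_partials_diff[OF D(3) D'(3)] by (simp add: algebra_simps)
qed

text \<open>
  Along the segment from \<open>t0\<close> to \<open>t\<close> the triple \<open>(f, f\<^sub>x, f\<^sub>y)\<close> solves a linear ordinary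
  differential equation with bounded coefficients, so its squared length \<open>E\<close> satisfies \<open>E' \<le> L E\<close>
  and vanishes with its initial value.
\<close>

lemma moving_frame_zero:
  fixes f :: "complex \<Rightarrow> 'a::real_inner"
  assumes mf: "moving_frame f p q" and t0: "t0 \<in> S" "f t0 = 0" "p t0 = 0" "q t0 = 0" and t: "t \<in> S"
  shows "f t = 0"
proof -
  define v where "v = t - t0"
  define l where "l = (\<lambda>s. t0 + complex_of_real s * v)"
  have l: "l s \<in> closed_segment t0 t" if "0 \<le> s" "s \<le> 1" for s
    using that by (auto simp: l_def v_def in_segment scaleR_conv_of_real algebra_simps)
  have "convex S"
    unfolding strip_def using interval_I is_interval_convex_1
      convex_linear_vimage[of Re I] by (simp add: vimage_def linear_linear bounded_linear.linear[OF bounded_linear_Re])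
  then have seg: "closed_segment t0 t \<subseteq> S"
    using t0(1) t by (simp add: closed_segment_subset)
  have "\<exists>B. \<forall>z\<in>closed_segment t0 t. \<bar>g z\<bar> \<le> B" if "Ck_on 0 S g" for g :: "complex \<Rightarrow> real"
  proof -
    have "continuous_on (closed_segment t0 t) g"
      using that continuous_on_subset[OF _ seg] by simp
    then have "bounded (g ` closed_segment t0 t)"
      by (simp add: compact_continuous_image compact_imp_bounded)
    then show ?thesis by (auto simp: bounded_iff)
  qed
  from this[OF smooth_coefficients(1)] this[OF smooth_coefficients(2)] this[OF smooth_coefficients(3)]
  obtain Ma Mb Mw where M: "\<And>z. z \<in> closed_segment t0 t \<Longrightarrow> \<bar>a (Re z)\<bar> \<le> Ma"
    "\<And>z. z \<in> closed_segment t0 t \<Longrightarrow> \<bar>b (Re z)\<bar> \<le> Mb"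
    "\<And>z. z \<in> closed_segment t0 t \<Longrightarrow> \<bar>exp (w (Re z))\<bar> \<le> Mw" by blast
  \<comment> \<open>Each of the eight terms of \<open>E' / 2\<close> below is a component of \<open>v\<close> times a coefficient times an inner
    product of two members of the frame, hence bounded by \<open>M E\<close>.\<close>
  define M where "M = (\<bar>Re v\<bar> + \<bar>Im v\<bar>) * (1 + Ma + Mb + 2 * Mw)"
  define E where "E = (\<lambda>s. f (l s) \<bullet> f (l s) + p (l s) \<bullet> p (l s) + q (l s) \<bullet> q (l s))"
  define df where "df = (\<lambda>s. Re v *\<^sub>R p (l s) + Im v *\<^sub>R q (l s))"
  define dp where "dp = (\<lambda>s. Re v *\<^sub>R (b (Re (l s)) *\<^sub>R p (l s) + (2 * exp (w (Re (l s)))) *\<^sub>R f (l s)) +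
      Im v *\<^sub>R a (Re (l s)) *\<^sub>R q (l s))"
  define dq where "dq = (\<lambda>s. Re v *\<^sub>R a (Re (l s)) *\<^sub>R q (l s) +
      Im v *\<^sub>R ((2 * exp (w (Re (l s)))) *\<^sub>R f (l s) - b (Re (l s)) *\<^sub>R p (l s)))"
  have "E 1 = 0"
  proof (rule vanishing_of_differential_inequality[of E])
    fix s :: real assume s: "0 \<le> s" "s \<le> 1"
    then have ls: "l s \<in> S" using l seg by blast
    note D = moving_frameD[OF mf ls, unfolded l_def, THEN has_partials_along_line, folded l_def]
    have D': "((\<lambda>s. f (l s)) has_vector_derivative df s) (at s)"
      "((\<lambda>s. p (l s)) has_vector_derivative dp s) (at s)"
      "((\<lambda>s. q (l s)) has_vector_derivative dq s) (at s)"
      using D unfolding df_def dp_def dq_def l_def by auto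
    note I = D'[unfolded has_vector_derivative_def]
    have "(E has_derivative (\<lambda>r. r * (2 * (f (l s) \<bullet> df s + p (l s) \<bullet> dp s + q (l s) \<bullet> dq s)))) (at s)"
      unfolding E_def
      by (rule derivative_eq_intros I refl)+ (auto simp: algebra_simps inner_commute)
    then show "(E has_real_derivative 2 * (f (l s) \<bullet> df s + p (l s) \<bullet> dp s + q (l s) \<bullet> dq s)) (at s)"
      by (simp add: has_field_derivative_def mult.commute[of _ "2 * _"] mult_commute_abs)
    have E0: "E s \<ge> 0" by (simp add: E_def)
    have ip: "\<bar>x \<bullet> y\<bar> \<le> E s" if "x \<in> {f (l s), p (l s), q (l s)}" "y \<in> {f (l s), p (l s), q (l s)}" for x y
    proof -
      have le: "z \<bullet> z \<le> E s" if "z \<in> {f (l s), p (l s), q (l s)}" for z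
        using that by (elim insertE emptyE) (simp_all add: E_def)
      have "\<bar>x \<bullet> y\<bar> \<le> norm x * norm y" by (rule Cauchy_Schwarz_ineq2)
      also have "\<dots> \<le> (x \<bullet> x + y \<bullet> y) / 2"
        using sum_squares_bound[of "norm x" "norm y"] by (simp add: power2_norm_eq_inner)
      also have "\<dots> \<le> E s"
        using add_mono[OF le[OF that(1)] le[OF that(2)]] by simp
      finally show ?thesis .
    qed
    have cM: "\<bar>k\<bar> * \<bar>c\<bar> * \<bar>x \<bullet> y\<bar> \<le> M * E s"
      if "k = Re v \<or> k = Im v" "c = 1 \<or> c = a (Re (l s)) \<or> c = b (Re (l s)) \<or> c = 2 * exp (w (Re (l s)))"
        "x \<in> {f (l s), p (l s), q (l s)}" "y \<in> {f (l s), p (l s), q (l s)}" for k c x y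
    proof -
      have "\<bar>c\<bar> \<le> 1 + Ma + Mb + 2 * Mw" "\<bar>k\<bar> \<le> \<bar>Re v\<bar> + \<bar>Im v\<bar>"
        using that(1,2) M[OF l[OF s]] by - (elim disjE; hypsubst; linarith)+
      then show ?thesis
        unfolding M_def using ip[OF that(3,4)] by (intro mult_mono) auto
    qed
    have cM': "k * (c * (x \<bullet> y)) \<le> M * E s" "- (k * (c * (x \<bullet> y))) \<le> M * E s"
      if "k = Re v \<or> k = Im v" "c = 1 \<or> c = a (Re (l s)) \<or> c = b (Re (l s)) \<or> c = 2 * exp (w (Re (l s)))"
        "x \<in> {f (l s), p (l s), q (l s)}" "y \<in> {f (l s), p (l s), q (l s)}" for k c x y
    proof -
      have "\<bar>k * (c * (x \<bullet> y))\<bar> = \<bar>k\<bar> * \<bar>c\<bar> * \<bar>x \<bullet> y\<bar>"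
        by (simp only: abs_mult mult.assoc)
      then show "k * (c * (x \<bullet> y)) \<le> M * E s" "- (k * (c * (x \<bullet> y))) \<le> M * E s"
        using cM[OF that] by (metis abs_le_D1, metis abs_le_D2)
    qed
    let ?f = "f (l s)" and ?p = "p (l s)" and ?q = "q (l s)" and ?x = "Re (l s)"
    have "f (l s) \<bullet> df s + p (l s) \<bullet> dp s + q (l s) \<bullet> dq s =
        Re v * (1 * (?f \<bullet> ?p)) + Im v * (1 * (?f \<bullet> ?q)) +
        Re v * (b ?x * (?p \<bullet> ?p)) + Re v * (2 * exp (w ?x) * (?p \<bullet> ?f)) + Im v * (a ?x * (?p \<bullet> ?q)) +
        Re v * (a ?x * (?q \<bullet> ?q)) + Im v * (2 * exp (w ?x) * (?q \<bullet> ?f)) - Im v * (b ?x * (?q \<bullet> ?p))"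
      unfolding df_def dp_def dq_def by (simp add: inner_add_right inner_diff_right algebra_simps)
    also have "\<dots> \<le> 8 * (M * E s)"
      using cM'(1)[of "Re v" 1 ?f ?p] cM'(1)[of "Im v" 1 ?f ?q] cM'(1)[of "Re v" "b ?x" ?p ?p]
        cM'(1)[of "Re v" "2 * exp (w ?x)" ?p ?f] cM'(1)[of "Im v" "a ?x" ?p ?q]
        cM'(1)[of "Re v" "a ?x" ?q ?q] cM'(1)[of "Im v" "2 * exp (w ?x)" ?q ?f]
        cM'(2)[of "Im v" "b ?x" ?q ?p] by simp
    finally show "2 * (f (l s) \<bullet> df s + p (l s) \<bullet> dp s + q (l s) \<bullet> dq s) \<le> (16 * M) * E s"
      by simp
  next
    show "E 0 = 0" using t0 by (simp add: E_def l_def)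
    show "E 1 \<ge> 0" by (simp add: E_def)
  qed
  moreover have "l 1 = t" by (simp add: l_def v_def)
  ultimately have "f t \<bullet> f t + p t \<bullet> p t + q t \<bullet> q t = 0" by (simp add: E_def)
  then have "f t \<bullet> f t = 0"
    using inner_ge_zero[of "f t"] inner_ge_zero[of "p t"] inner_ge_zero[of "q t"] by linarith
  then show ?thesis by simp
qed

text \<open>
  The matrix \<open>A\<close> carries the frame of \<open>f\<close> at a base point to that of \<open>g\<close>. The two frames have the
  same volume up to sign, whence \<open>det A = \<plusminus>1\<close>; in odd dimension the negative sign is absorbed by \<open>- A\<close>.
\<close>

lemma gives_rise_to_unique:
  assumes f: "gives_rise_to S (\<lambda>t. w (Re t)) f" and g: "gives_rise_to S (\<lambda>t. w (Re t)) g"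
  shows "equiaffinely_equivalent S f g \<or> equiaffinely_equivalent S f (\<lambda>t. - g t)"
proof -
  obtain x where "x \<in> I" using nonempty_I by blast
  define t0 where "t0 = complex_of_real x"
  have t0: "t0 \<in> S" using \<open>x \<in> I\<close> by (simp add: t0_def strip_def)
  define F :: "real^3^3" where "F = vector [dirder 1 f t0, dirder \<i> f t0, f t0]"
  define G :: "real^3^3" where "G = vector [dirder 1 g t0, dirder \<i> g t0, g t0]"
  note dets = moving_frame_of_gives_rise_to(2)[OF f t0] moving_frame_of_gives_rise_to(2)[OF g t0]
  have detFG: "\<bar>det F\<bar> = \<bar>det G\<bar>" "det F \<noteq> 0"
    using dets by (auto simp: F_def G_def)
  have "invertible (transpose F)"
    using detFG by (simp add: invertible_det_nz det_transpose)
  then obtain B where "B ** transpose F = mat 1"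
    unfolding invertible_def by blast
  then obtain A where AF: "A ** transpose F = transpose G"
    by (metis matrix_mul_assoc matrix_mul_rid)
  have "det A * det F = det G" using AF by (metis det_mul det_transpose)
  then have detA: "det A = 1 \<or> det A = - 1"
    using detFG by (metis abs_mult abs_eq_iff mult_cancel_right1 abs_1 abs_0_eq)
  have row: "A *v (F $ i) = G $ i" for i
  proof -
    have "(A *v (F $ i)) $ j = (A ** transpose F) $ j $ i" for j
      by (simp add: matrix_vector_mult_def matrix_matrix_mult_def transpose_def)
    then show ?thesis unfolding AF by (simp add: vec_eq_iff transpose_def)
  qed
  have 0: "A *v dirder 1 f t0 = dirder 1 g t0" "A *v dirder \<i> f t0 = dirder \<i> g t0" "A *v f t0 = g t0"
    using row[of 1] row[of 2] row[of 3] by (simp_all add: F_def G_def vector_3)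
  have AT: "A *v f t = g t" if "t \<in> S" for t
    using moving_frame_zero[OF moving_frame_diff[OF
          moving_frame_linear[OF matrix_vector_mul_bounded_linear[of A] moving_frame_of_gives_rise_to(1)[OF f]]
          moving_frame_of_gives_rise_to(1)[OF g]] t0 _ _ _ that] 0 by simp
  show ?thesis
  proof (cases "det A = 1")
    case True
    then show ?thesis using AT by (auto simp: equiaffinely_equivalent_def)
  next
    case False
    then have "det (- A) = 1" using detA by (simp add: det_3)
    moreover have "- g t = (- A) *v f t" if "t \<in> S" for t
      using AT[OF that] by (simp add: vec_eq_iff matrix_vector_mult_def sum_negf)
    ultimately show ?thesis unfolding equiaffinely_equivalent_def by blast
  qed
qed

end

section \<open>Conics as slices\<close>

lemma orthonormal_pair_axis: "i \<noteq> j \<Longrightarrow> orthonormal_pair (axis i 1) (axis j 1)"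
  by (simp add: orthonormal_pair_def inner_axis_axis)

lemma is_circle_slice:
  fixes c :: "real^3"
  assumes "m > 0" "k \<noteq> 0"
  shows "is_circle (range (\<lambda>y. m *\<^sub>R (cos (k * y) *\<^sub>R axis 1 1 + sin (k * y) *\<^sub>R axis 2 1) + c))"
  unfolding is_circle_def
proof (intro exI conjI)
  show "orthonormal_pair (axis 1 1 :: real^3) (axis 2 1)" by (rule orthonormal_pair_axis) simp
  show "range (\<lambda>y. m *\<^sub>R (cos (k * y) *\<^sub>R axis 1 1 + sin (k * y) *\<^sub>R axis 2 1) + c) =
    {c + a *\<^sub>R axis 1 1 + b *\<^sub>R axis 2 1 | a b. a\<^sup>2 + b\<^sup>2 = m\<^sup>2}" (is "?L = ?R")
  proof (intro equalityI subsetI)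
    fix v assume "v \<in> ?L"
    then obtain y where "v = c + (m * cos (k * y)) *\<^sub>R axis 1 1 + (m * sin (k * y)) *\<^sub>R axis 2 1"
      by (auto simp: algebra_simps)
    moreover have "(m * cos (k * y))\<^sup>2 + (m * sin (k * y))\<^sup>2 = m\<^sup>2"
      by (simp add: power_mult_distrib flip: distrib_left)
    ultimately show "v \<in> ?R" by blast
  next
    fix v assume "v \<in> ?R"
    then obtain a b where v: "v = c + a *\<^sub>R axis 1 1 + b *\<^sub>R axis 2 1" and ab: "a\<^sup>2 + b\<^sup>2 = m\<^sup>2" by blast
    have "(a / m)\<^sup>2 + (b / m)\<^sup>2 = 1"
      using ab assms by (simp add: power_divide flip: add_divide_distrib)
    then obtain \<theta> where "a / m = cos \<theta>" "b / m = sin \<theta>" using sincos_total_2pi by metis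
    then have "a = m * cos (k * (\<theta> / k))" "b = m * sin (k * (\<theta> / k))"
      using assms by (simp_all add: field_simps)
    then show "v \<in> ?L" unfolding v by (intro range_eqI[of _ _ "\<theta> / k"]) (simp add: algebra_simps)
  qed
qed (use assms in simp)

lemma is_hyperbola_branch_slice:
  fixes c :: "real^3"
  assumes "m > 0" "k \<noteq> 0"
  shows "is_hyperbola_branch (range (\<lambda>y. m *\<^sub>R (cosh (k * y) *\<^sub>R axis 1 1 + sinh (k * y) *\<^sub>R axis 2 1) + c))"
  unfolding is_hyperbola_branch_def
proof (intro exI conjI)
  show "orthonormal_pair (axis 1 1 :: real^3) (axis 2 1)" by (rule orthonormal_pair_axis) simp
  show "range (\<lambda>y. m *\<^sub>R (cosh (k * y) *\<^sub>R axis 1 1 + sinh (k * y) *\<^sub>R axis 2 1) + c) =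
    {c + a *\<^sub>R axis 1 1 + b *\<^sub>R axis 2 1 | a b. a\<^sup>2 / m\<^sup>2 - b\<^sup>2 / m\<^sup>2 = 1 \<and> a > 0}" (is "?L = ?R")
  proof (intro equalityI subsetI)
    fix v assume "v \<in> ?L"
    then obtain y where "v = c + (m * cosh (k * y)) *\<^sub>R axis 1 1 + (m * sinh (k * y)) *\<^sub>R axis 2 1"
      by (auto simp: algebra_simps)
    moreover have "(m * cosh (k * y))\<^sup>2 / m\<^sup>2 - (m * sinh (k * y))\<^sup>2 / m\<^sup>2 = 1"
      using assms by (simp add: power_mult_distrib hyperbolic_pythagoras)
    moreover have "m * cosh (k * y) > 0" using assms by simp
    ultimately show "v \<in> ?R" by blast
  next
    fix v assume "v \<in> ?R"
    then obtain a b where v: "v = c + a *\<^sub>R axis 1 1 + b *\<^sub>R axis 2 1"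
      and ab: "a\<^sup>2 / m\<^sup>2 - b\<^sup>2 / m\<^sup>2 = 1" "a > 0" by blast
    \<comment> \<open>On a branch \<open>a > 0\<close> is determined by \<open>b\<close>, so matching the second coordinate suffices.\<close>
    define y where "y = arsinh (b / m) / k"
    have y: "sinh (k * y) = b / m" using assms by (simp add: y_def)
    have "(cosh (k * y))\<^sup>2 = (a / m)\<^sup>2"
      using ab by (simp add: cosh_square_eq y power_divide)
    moreover have "cosh (k * y) \<ge> 0" "a / m \<ge> 0" using ab assms by simp_all
    ultimately have "cosh (k * y) = a / m" by (simp only: power2_eq_iff_nonneg)
    then show "v \<in> ?L" using y assms unfolding v
      by (intro range_eqI[of _ _ y]) (simp add: algebra_simps)
  qed
qed (use assms in simp_all)

lemma is_parabola_slice: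
  fixes c :: "real^3"
  assumes "m > 0"
  shows "is_parabola (range (\<lambda>y. m *\<^sub>R ((y\<^sup>2 / 2) *\<^sub>R axis 1 1 + y *\<^sub>R axis 2 1) + c))"
  unfolding is_parabola_def
proof (intro exI conjI)
  show "orthonormal_pair (axis 2 1 :: real^3) (axis 1 1)" by (rule orthonormal_pair_axis) simp
  show "range (\<lambda>y. m *\<^sub>R ((y\<^sup>2 / 2) *\<^sub>R axis 1 1 + y *\<^sub>R axis 2 1) + c) =
    {c + a *\<^sub>R axis 2 1 + b *\<^sub>R axis 1 1 | a b. b = 1 / (2 * m) * a\<^sup>2}" (is "?L = ?R")
  proof (intro equalityI subsetI)
    fix v assume "v \<in> ?L"
    then obtain y where "v = c + (m * y) *\<^sub>R axis 2 1 + (m * (y\<^sup>2 / 2)) *\<^sub>R axis 1 1"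
      by (auto simp: algebra_simps)
    moreover have "m * (y\<^sup>2 / 2) = 1 / (2 * m) * (m * y)\<^sup>2"
      using assms by (simp add: power2_eq_square field_simps)
    ultimately show "v \<in> ?R" by blast
  next
    fix v assume "v \<in> ?R"
    then obtain a where "v = c + a *\<^sub>R axis 2 1 + (1 / (2 * m) * a\<^sup>2) *\<^sub>R axis 1 1" by blast
    then show "v \<in> ?L" using assms
      by (intro range_eqI[of _ _ "a / m"]) (simp add: algebra_simps power2_eq_square)
  qed
qed (use assms in simp)

lemma conic_uminus:
  shows "is_circle C \<Longrightarrow> is_circle (uminus ` C)"
    and "is_hyperbola_branch C \<Longrightarrow> is_hyperbola_branch (uminus ` C)"
    and "is_parabola C \<Longrightarrow> is_parabola (uminus ` C)"
proof -
  have on: "orthonormal_pair (- u) (- v)" if "orthonormal_pair u v" for u v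
    using that by (simp add: orthonormal_pair_def)
  have im: "uminus ` {p + a *\<^sub>R u + b *\<^sub>R v | a b. P a b} = {- p + a *\<^sub>R - u + b *\<^sub>R - v | a b. P a b}"
    for p u v :: "real^3" and P
  proof -
    have eq: "- (p + a *\<^sub>R u + b *\<^sub>R v) = - p + a *\<^sub>R - u + b *\<^sub>R - v" for a b by simp
    show ?thesis
    proof (intro equalityI subsetI)
      fix x assume "x \<in> {- p + a *\<^sub>R - u + b *\<^sub>R - v | a b. P a b}"
      then obtain a b where "x = - (p + a *\<^sub>R u + b *\<^sub>R v)" "P a b" unfolding eq by blast
      then show "x \<in> uminus ` {p + a *\<^sub>R u + b *\<^sub>R v | a b. P a b}" by blast
    next
      fix x assume "x \<in> uminus ` {p + a *\<^sub>R u + b *\<^sub>R v | a b. P a b}"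
      then obtain a b where "x = - (p + a *\<^sub>R u + b *\<^sub>R v)" "P a b" by blast
      then show "x \<in> {- p + a *\<^sub>R - u + b *\<^sub>R - v | a b. P a b}" unfolding eq by blast
    qed
  qed
  show "is_circle (uminus ` C)" if C: "is_circle C"
  proof -
    obtain p u v r where *: "orthonormal_pair u v" "r > 0"
      "C = {p + a *\<^sub>R u + b *\<^sub>R v | a b. a\<^sup>2 + b\<^sup>2 = r\<^sup>2}"
      using C unfolding is_circle_def by blast
    show ?thesis unfolding is_circle_def *(3) im using on[OF *(1)] *(2) by blast
  qed
  show "is_hyperbola_branch (uminus ` C)" if C: "is_hyperbola_branch C"
  proof -
    obtain p u v \<alpha> \<beta> where *: "orthonormal_pair u v" "\<alpha> > 0" "\<beta> > 0"
      "C = {p + a *\<^sub>R u + b *\<^sub>R v | a b. a\<^sup>2 / \<alpha>\<^sup>2 - b\<^sup>2 / \<beta>\<^sup>2 = 1 \<and> a > 0}"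
      using C unfolding is_hyperbola_branch_def by blast
    show ?thesis unfolding is_hyperbola_branch_def *(4) im using on[OF *(1)] *(2,3) by blast
  qed
  show "is_parabola (uminus ` C)" if C: "is_parabola C"
  proof -
    obtain p u v k where *: "orthonormal_pair u v" "k > 0"
      "C = {p + a *\<^sub>R u + b *\<^sub>R v | a b. b = k * a\<^sup>2}"
      using C unfolding is_parabola_def by blast
    show ?thesis unfolding is_parabola_def *(3) im using on[OF *(1)] *(2) by blast
  qed
qed

section \<open>Solutions with separated variables\<close>

text \<open>
  The interval may be unbounded, so its end points are taken in the extended reals.
\<close>

lemma antiderivative_on_open_interval:
  fixes g :: "real \<Rightarrow> real"
  assumes "open I" "is_interval I" "I \<noteq> {}" "continuous_on I g"
  obtains G where "\<And>x. x \<in> I \<Longrightarrow> (G has_real_derivative g x) (at x)"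
proof -
  define \<alpha> where "\<alpha> = (INF x\<in>I. ereal x)"
  define \<beta> where "\<beta> = (SUP x\<in>I. ereal x)"
  have mem: "x \<in> I \<longleftrightarrow> \<alpha> < ereal x \<and> ereal x < \<beta>" for x
  proof
    assume "x \<in> I"
    then obtain e where e: "e > 0" "ball x e \<subseteq> I"
      using \<open>open I\<close> open_contains_ball by blast
    have "x - e/2 \<in> I" "x + e/2 \<in> I"
      using e by (auto simp: subset_iff dist_real_def)
    moreover have "ereal (x - e/2) < ereal x" "ereal x < ereal (x + e/2)" using e by auto
    ultimately show "\<alpha> < ereal x \<and> ereal x < \<beta>"
      unfolding \<alpha>_def \<beta>_def INF_less_iff less_SUP_iff by blast
  next
    assume "\<alpha> < ereal x \<and> ereal x < \<beta>"
    then obtain y z where "y \<in> I" "y < x" "z \<in> I" "x < z"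
      unfolding \<alpha>_def \<beta>_def INF_less_iff less_SUP_iff by auto
    then show "x \<in> I"
      using \<open>is_interval I\<close> mem_is_interval_1_I[of I y z x] by simp
  qed
  have "\<alpha> < \<beta>" using mem \<open>I \<noteq> {}\<close> less_trans by blast
  moreover have "isCont g x" if "\<alpha> < ereal x" "ereal x < \<beta>" for x
    using that mem assms(1,4) by (simp add: continuous_on_eq_continuous_at)
  ultimately obtain G where "\<forall>x::real. \<alpha> < x \<longrightarrow> x < \<beta> \<longrightarrow> (G has_vector_derivative g x) (at x)"
    using einterval_antiderivative[of \<alpha> \<beta> g] by blast
  then show ?thesis
    using that mem by (auto simp: has_real_derivative_iff_has_vector_derivative)
qed

lemma det_cylindrical_frame:
  fixes U V :: "real^3"
  assumes "U $ 3 = 0" "V $ 3 = 0"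
  shows "det (vector [\<alpha> *\<^sub>R U + r1 *\<^sub>R axis 3 1, V, U + r *\<^sub>R axis 3 1] :: real^3^3)
    = (U $ 1 * V $ 2 - U $ 2 * V $ 1) * (\<alpha> * r - r1)"
  using assms by (simp add: det_3 vector_3 axis_def algebra_simps)

context tzitzeica_profile
begin

lemma dw_ab: "x \<in> I \<Longrightarrow> (w has_real_derivative a x + b x) (at x)"
  using dw[of x] by (simp add: a_def b_def)

lemma exp_w_ab: "exp (- w x) = (a x - b x) / 2"
  by (simp add: a_def b_def)

text \<open>
  In terms of \<open>a\<close> and \<open>b\<close> the Tzitzeica equation is a pair of Riccati equations exchanged by
  \<open>a \<leftrightarrow> b\<close>; here \<open>e\<^sup>-\<^sup>2\<^sup>w\<close> has been eliminated through \<open>a - b = 2 e\<^sup>-\<^sup>w\<close>.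
\<close>

lemma da: "x \<in> I \<Longrightarrow> (a has_real_derivative 2 * exp (w x) + a x * b x - (a x)\<^sup>2) (at x)"
  and db: "x \<in> I \<Longrightarrow> (b has_real_derivative 2 * exp (w x) + a x * b x - (b x)\<^sup>2) (at x)"
proof -
  assume x: "x \<in> I"
  have e: "exp (- 2 * w x) = exp (- w x) * exp (- w x)" by (simp flip: exp_add)
  have "((\<lambda>x. w1 x / 2 + exp (- w x)) has_real_derivative 2 * exp (w x) + a x * b x - (a x)\<^sup>2) (at x)"
    by (rule DERIV_cong[OF DERIV_add[OF DERIV_cdivide[OF dw1[OF x]] DERIV_fun_exp[OF DERIV_minus[OF dw[OF x]]]]])
      (simp only: a_def b_def e, simp add: field_simps power2_eq_square)
  then show "(a has_real_derivative 2 * exp (w x) + a x * b x - (a x)\<^sup>2) (at x)"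
    by (simp add: a_def[abs_def])
  have "((\<lambda>x. w1 x / 2 - exp (- w x)) has_real_derivative 2 * exp (w x) + a x * b x - (b x)\<^sup>2) (at x)"
    by (rule DERIV_cong[OF DERIV_diff[OF DERIV_cdivide[OF dw1[OF x]] DERIV_fun_exp[OF DERIV_minus[OF dw[OF x]]]]])
      (simp only: a_def b_def e, simp add: field_simps power2_eq_square)
  then show "(b has_real_derivative 2 * exp (w x) + a x * b x - (b x)\<^sup>2) (at x)"
    by (simp add: b_def[abs_def])
qed

text \<open>
  This is the energy integral of \<open>w'' = 4 (e\<^sup>w - e\<^sup>-\<^sup>2\<^sup>w)\<close>: \<open>2 e\<^sup>w - a b = 2 e\<^sup>w + e\<^sup>-\<^sup>2\<^sup>w - w'\<^sup>2/4\<close>.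
\<close>

lemma first_integral: obtains C where "\<And>x. x \<in> I \<Longrightarrow> 2 * exp (w x) - a x * b x = C"
proof -
  have "((\<lambda>x. 2 * exp (w x) - a x * b x) has_real_derivative 0) (at x within I)" if "x \<in> I" for x
    by (rule DERIV_subset[OF DERIV_cong[OF
            DERIV_diff[OF DERIV_cmult[OF DERIV_fun_exp[OF dw_ab[OF that]]] DERIV_mult[OF da[OF that] db[OF that]]]]])
      (simp_all add: algebra_simps power2_eq_square)
  moreover have "convex I" using interval_I is_interval_convex by blast
  ultimately obtain C where "\<forall>x\<in>I. 2 * exp (w x) - a x * b x = C"
    using has_field_derivative_zero_constant[of I "\<lambda>x. 2 * exp (w x) - a x * b x"] by blast
  then show ?thesis using that by blast
qed

text \<open>
  The separated form comes from \<open>f\<^sub>x\<^sub>y = a f\<^sub>y\<close>, which says \<open>f\<^sub>y = m(x) V(y)\<close>. The equation for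
  \<open>f\<^sub>x\<^sub>x\<close> holds because \<open>m'' = (a' + a\<^sup>2) m = (2 e\<^sup>w + a b) m\<close>; in the one for \<open>f\<^sub>y\<^sub>y\<close> the factor
  of \<open>m U\<close> is \<open>2 e\<^sup>w - a b\<close>, so that only the first integral \<open>C\<close> survives, and the vector \<open>Z\<close> is what the
  part without \<open>y\<close> contributes.
\<close>

lemma moving_frame_separated:
  fixes U :: "real \<Rightarrow> 'a::real_normed_vector"
  assumes C: "\<And>x. x \<in> I \<Longrightarrow> 2 * exp (w x) - a x * b x = C"
    and m: "\<And>x. x \<in> I \<Longrightarrow> (m has_real_derivative a x * m x) (at x)"
    and U: "\<And>y. (U has_vector_derivative U1 y) (at y)"
      "\<And>y. (U1 has_vector_derivative C *\<^sub>R U y + Z) (at y)"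
    and K: "\<And>x. x \<in> I \<Longrightarrow> (K has_vector_derivative K1 x) (at x)"
      "\<And>x. x \<in> I \<Longrightarrow> (K1 has_vector_derivative b x *\<^sub>R K1 x + (2 * exp (w x)) *\<^sub>R K x) (at x)"
    and Z: "\<And>x. x \<in> I \<Longrightarrow> m x *\<^sub>R Z = (2 * exp (w x)) *\<^sub>R K x - b x *\<^sub>R K1 x"
  shows "moving_frame (\<lambda>t. m (Re t) *\<^sub>R U (Im t) + K (Re t))
    (\<lambda>t. (a (Re t) * m (Re t)) *\<^sub>R U (Im t) + K1 (Re t)) (\<lambda>t. m (Re t) *\<^sub>R U1 (Im t))"
  unfolding moving_frame_def
proof (intro ballI conjI)
  fix t assume "t \<in> S"
  then have x: "Re t \<in> I" by (simp add: strip_def)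
  let ?x = "Re t" and ?y = "Im t"
  have C': "C = 2 * exp (w ?x) - a ?x * b ?x" using C[OF x] by simp
  have Pm: "has_partials (\<lambda>s. m (Re s)) (a ?x * m ?x) 0 t"
    using m[OF x] by (intro has_partials_Re) (simp add: has_real_derivative_iff_has_vector_derivative)
  have "((\<lambda>x. a x * m x) has_real_derivative (2 * exp (w ?x) + a ?x * b ?x) * m ?x) (at ?x)"
    by (rule DERIV_cong[OF DERIV_mult[OF da[OF x] m[OF x]]]) (simp add: algebra_simps power2_eq_square)
  then have Pam: "has_partials (\<lambda>s. a (Re s) * m (Re s)) ((2 * exp (w ?x) + a ?x * b ?x) * m ?x) 0 t"
    using has_partials_Re[of "\<lambda>x. a x * m x"] by (simp add: has_real_derivative_iff_has_vector_derivative)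
  note PU = has_partials_Im[OF U(1), of t] and PU1 = has_partials_Im[OF U(2), of t]
  note PK = has_partials_Re[OF K(1)[OF x]] and PK1 = has_partials_Re[OF K(2)[OF x]]
  show "has_partials (\<lambda>t. m (Re t) *\<^sub>R U (Im t) + K (Re t))
    ((a ?x * m ?x) *\<^sub>R U ?y + K1 ?x) (m ?x *\<^sub>R U1 ?y) t"
    using has_partials_add[OF has_partials_scaleR[OF Pm PU] PK] by simp
  show "has_partials (\<lambda>t. (a (Re t) * m (Re t)) *\<^sub>R U (Im t) + K1 (Re t))
     (b ?x *\<^sub>R ((a ?x * m ?x) *\<^sub>R U ?y + K1 ?x) + (2 * exp (w ?x)) *\<^sub>R (m ?x *\<^sub>R U ?y + K ?x))
     (a ?x *\<^sub>R m ?x *\<^sub>R U1 ?y) t"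
    using has_partials_add[OF has_partials_scaleR[OF Pam PU] PK1] by (simp add: algebra_simps)
  have "m ?x *\<^sub>R (C *\<^sub>R U ?y + Z) = (2 * exp (w ?x)) *\<^sub>R (m ?x *\<^sub>R U ?y + K ?x) -
      b ?x *\<^sub>R ((a ?x * m ?x) *\<^sub>R U ?y + K1 ?x)"
    unfolding scaleR_add_right Z[OF x] C' by (simp add: algebra_simps)
  then show "has_partials (\<lambda>t. m (Re t) *\<^sub>R U1 (Im t)) (a ?x *\<^sub>R m ?x *\<^sub>R U1 ?y)
     ((2 * exp (w ?x)) *\<^sub>R (m ?x *\<^sub>R U ?y + K ?x) - b ?x *\<^sub>R ((a ?x * m ?x) *\<^sub>R U ?y + K1 ?x)) t"
    using has_partials_scaleR[OF Pm PU1] by simp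
qed

end

section \<open>The model and the classification\<close>

context tzitzeica_profile
begin

definition conic_slices :: "(complex \<Rightarrow> real^3) \<Rightarrow> bool" where
  "conic_slices g \<longleftrightarrow>
    (\<forall>x\<in>I. is_circle (slice_curve g x)) \<or>
    (\<forall>x\<in>I. is_hyperbola_branch (slice_curve g x)) \<or>
    (\<forall>x\<in>I. is_parabola (slice_curve g x))"

text \<open>
  The model for each sign of the first integral \<open>C\<close>. The two cases \<open>C \<noteq> 0\<close> differ only in the
  fundamental system of \<open>U'' = C U\<close>, whose Wronskian is \<open>k = \<surd>\<bar>C\<bar>\<close>.
\<close>

lemma conic_model: "\<exists>g. gives_rise_to S (\<lambda>t. w (Re t)) g \<and> conic_slices g"
proof -
  let ?e = "\<lambda>i. axis i 1 :: real^3"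
  have "continuous_on I a" "continuous_on I b"
    using DERIV_isCont[OF da] DERIV_isCont[OF db] by (auto intro: continuous_at_imp_continuous_on)
  then have cont: "continuous_on I (\<lambda>x. (a x - b x) / 2)"
    by (intro continuous_intros) auto
  from antiderivative_on_open_interval[OF open_I interval_I nonempty_I cont]
  obtain P where dP: "\<And>x. x \<in> I \<Longrightarrow> (P has_real_derivative (a x - b x) / 2) (at x)" by blast
  obtain C where C: "\<And>x. x \<in> I \<Longrightarrow> 2 * exp (w x) - a x * b x = C"
    using first_integral by blast
  define m where "m x = exp (w x / 2 + P x)" for x
  define q where "q x = exp (- 2 * P x)" for x
  \<comment> \<open>The function \<open>n\<close> spans the solutions of the system that depend on \<open>x\<close> alone: it satisfies
    \<open>b n' = 2 e\<^sup>w n\<close>. Its derivative is \<open>n1\<close>.\<close>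
  define n where "n x = b x * q x" for x
  define n1 where "n1 x = 2 * exp (w x) * q x" for x
  have m_pos: "m x > 0" for x by (simp add: m_def)
  have m2q: "(m x)\<^sup>2 * q x = exp (w x)" for x
    by (simp add: m_def q_def power2_eq_square flip: exp_add)
  have dm: "(m has_real_derivative a x * m x) (at x)" if "x \<in> I" for x
    unfolding m_def[abs_def]
    by (rule DERIV_cong[OF DERIV_fun_exp[OF DERIV_add[OF DERIV_cdivide[OF dw_ab[OF that]] dP[OF that]]]])
      (simp add: field_simps)
  have dq: "(q has_real_derivative - (a x - b x) * q x) (at x)" if "x \<in> I" for x
    unfolding q_def[abs_def]
    by (rule DERIV_cong[OF DERIV_fun_exp[OF DERIV_cmult[OF dP[OF that]]]]) (simp add: field_simps)
  have dn: "(n has_real_derivative n1 x) (at x)" if "x \<in> I" for x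
    unfolding n_def[abs_def] n1_def
    by (rule DERIV_cong[OF DERIV_mult[OF db[OF that] dq[OF that]]])
      (simp add: algebra_simps power2_eq_square)
  have dn1: "(n1 has_real_derivative b x * n1 x + 2 * exp (w x) * n x) (at x)" if "x \<in> I" for x
    unfolding n1_def[abs_def] n_def
    by (rule DERIV_cong[OF DERIV_mult[OF DERIV_cmult[OF DERIV_fun_exp[OF dw_ab[OF that]]] dq[OF that]]])
      (simp add: algebra_simps)
  have vd: "((\<lambda>x. g x *\<^sub>R c) has_vector_derivative g' *\<^sub>R c) (at x)"
    if "(g has_real_derivative g') (at x)" for g :: "real \<Rightarrow> real" and g' x and c :: "real^3"
    using has_vector_derivative_scaleR[OF that has_vector_derivative_const[of c]] by simp
  have slice: "slice_curve (\<lambda>t. m (Re t) *\<^sub>R U (Im t) + K (Re t)) x = range (\<lambda>y. m x *\<^sub>R U y + K x)"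
    for U K :: "real \<Rightarrow> real^3" and x
    by (simp add: slice_curve_def)
  have nonzero: ?thesis
    if C0: "C \<noteq> 0"
      and U: "\<And>y. (U has_vector_derivative U1 y) (at y)"
        "\<And>y. (U1 has_vector_derivative C *\<^sub>R U y) (at y)"
      and U3: "\<And>y. U y $ 3 = 0" "\<And>y. U1 y $ 3 = 0"
      and W: "\<And>y. U y $ 1 * U1 y $ 2 - U y $ 2 * U1 y $ 1 = k" "k > 0"
      and conic: "\<And>c. conic_slices (\<lambda>t. m (Re t) *\<^sub>R U (Im t) + c (Re t))"
    for U U1 k
  proof -
    \<comment> \<open>The determinant of the frame is \<open>- \<rho> k C e\<^sup>w\<close>, which is to have absolute value \<open>2 e\<^sup>w\<close>.\<close>
    define \<rho> where "\<rho> = 2 / (k * \<bar>C\<bar>)"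
    let ?K = "\<lambda>x. (\<rho> * n x) *\<^sub>R ?e 3" and ?K1 = "\<lambda>x. (\<rho> * n1 x) *\<^sub>R ?e 3"
    have mf: "moving_frame (\<lambda>t. m (Re t) *\<^sub>R U (Im t) + ?K (Re t))
      (\<lambda>t. (a (Re t) * m (Re t)) *\<^sub>R U (Im t) + ?K1 (Re t)) (\<lambda>t. m (Re t) *\<^sub>R U1 (Im t))"
    proof (rule moving_frame_separated[OF C dm U(1), where Z = 0])
      fix x assume x: "x \<in> I"
      show "(?K has_vector_derivative ?K1 x) (at x)"
        by (rule vd[OF DERIV_cmult[OF dn[OF x]]])
      show "(?K1 has_vector_derivative b x *\<^sub>R ?K1 x + (2 * exp (w x)) *\<^sub>R ?K x) (at x)"
        using vd[OF DERIV_cmult[OF dn1[OF x], of \<rho>], of "?e 3"] by (simp add: algebra_simps)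
      show "m x *\<^sub>R 0 = (2 * exp (w x)) *\<^sub>R ?K x - b x *\<^sub>R ?K1 x"
        by (simp add: n_def n1_def algebra_simps)
    qed (use U(2) in simp_all)
    have "gives_rise_to S (\<lambda>t. w (Re t)) (\<lambda>t. m (Re t) *\<^sub>R U (Im t) + ?K (Re t))"
    proof (rule gives_rise_to_of_moving_frame[OF mf])
      fix t assume "t \<in> S"
      then have x: "Re t \<in> I" by (simp add: strip_def)
      let ?x = "Re t" and ?U = "U (Im t)" and ?V = "U1 (Im t)"
      have "det (vector [(a ?x * m ?x) *\<^sub>R ?U + ?K1 ?x, m ?x *\<^sub>R ?V, m ?x *\<^sub>R ?U + ?K ?x] :: real^3^3)
        = ((m ?x *\<^sub>R ?U) $ 1 * (m ?x *\<^sub>R ?V) $ 2 - (m ?x *\<^sub>R ?U) $ 2 * (m ?x *\<^sub>R ?V) $ 1)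
          * (a ?x * (\<rho> * n ?x) - \<rho> * n1 ?x)"
        using det_cylindrical_frame[of "m ?x *\<^sub>R ?U" "m ?x *\<^sub>R ?V" "a ?x" "\<rho> * n1 ?x" "\<rho> * n ?x"]
        by (simp add: U3)
      also have "\<dots> = (m ?x)\<^sup>2 * (?U $ 1 * ?V $ 2 - ?U $ 2 * ?V $ 1) * \<rho> * (a ?x * n ?x - n1 ?x)"
        by (simp add: algebra_simps power2_eq_square)
      also have "a ?x * n ?x - n1 ?x = - (C * q ?x)"
        unfolding C[OF x, symmetric] by (simp add: n_def n1_def algebra_simps)
      also have "(m ?x)\<^sup>2 * (?U $ 1 * ?V $ 2 - ?U $ 2 * ?V $ 1) * \<rho> * - (C * q ?x) =
          - (((m ?x)\<^sup>2 * q ?x) * (k * \<rho> * C))"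
        unfolding W(1) by (simp add: algebra_simps)
      finally show "\<bar>det (vector [(a ?x * m ?x) *\<^sub>R ?U + ?K1 ?x, m ?x *\<^sub>R ?V, m ?x *\<^sub>R ?U + ?K ?x] :: real^3^3)\<bar>
        = 2 * exp (w ?x)"
        using C0 W(2) by (simp add: m2q abs_mult \<rho>_def)
    qed
    then show ?thesis using conic[of ?K] by blast
  qed
  consider "C < 0" | "C > 0" | "C = 0" by linarith
  then show ?thesis
  proof cases
    case 1
    define k where "k = sqrt (- C)"
    have k: "k > 0" "k * k = - C" using 1 by (simp_all add: k_def)
    let ?U = "\<lambda>y. cos (k * y) *\<^sub>R ?e 1 + sin (k * y) *\<^sub>R ?e 2"
    let ?U1 = "\<lambda>y. (- k * sin (k * y)) *\<^sub>R ?e 1 + (k * cos (k * y)) *\<^sub>R ?e 2"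
    show ?thesis
    proof (rule nonzero[of ?U ?U1 k])
      fix y
      have d: "((\<lambda>y. cos (k * y)) has_real_derivative - k * sin (k * y)) (at y)"
        "((\<lambda>y. sin (k * y)) has_real_derivative k * cos (k * y)) (at y)"
        by (auto intro!: derivative_eq_intros)
      show "(?U has_vector_derivative ?U1 y) (at y)"
        by (rule has_vector_derivative_add[OF vd[OF d(1)] vd[OF d(2)]])
      have "(?U1 has_vector_derivative (- k * (k * cos (k * y))) *\<^sub>R ?e 1
          + (k * (- k * sin (k * y))) *\<^sub>R ?e 2) (at y)"
        by (rule has_vector_derivative_add[OF vd[OF DERIV_cmult[OF d(2)]] vd[OF DERIV_cmult[OF d(1)]]])
      moreover have "- k * (k * z) = C * z" "k * (- k * z) = C * z" for z
        using k(2) by (simp_all add: mult.assoc[symmetric])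
      ultimately show "(?U1 has_vector_derivative C *\<^sub>R ?U y) (at y)"
        by (simp only: scaleR_add_right scaleR_scaleR)
      show "?U y $ 1 * ?U1 y $ 2 - ?U y $ 2 * ?U1 y $ 1 = k"
        using sin_cos_squared_add[of "k * y"]
        by (simp add: axis_def power2_eq_square algebra_simps flip: distrib_left)
      show "?U y $ 3 = 0" "?U1 y $ 3 = 0" by (simp_all add: axis_def)
    next
      fix c
      show "conic_slices (\<lambda>t. m (Re t) *\<^sub>R ?U (Im t) + c (Re t))"
        unfolding conic_slices_def slice[of ?U c] using is_circle_slice[OF m_pos less_imp_neq[OF k(1), symmetric]] by blast
    qed (use 1 k in simp_all)
  next
    case 2
    define k where "k = sqrt C"
    have k: "k > 0" "k * k = C" using 2 by (simp_all add: k_def)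
    let ?U = "\<lambda>y. cosh (k * y) *\<^sub>R ?e 1 + sinh (k * y) *\<^sub>R ?e 2"
    let ?U1 = "\<lambda>y. (k * sinh (k * y)) *\<^sub>R ?e 1 + (k * cosh (k * y)) *\<^sub>R ?e 2"
    show ?thesis
    proof (rule nonzero[of ?U ?U1 k])
      fix y
      have d: "((\<lambda>y. cosh (k * y)) has_real_derivative k * sinh (k * y)) (at y)"
        "((\<lambda>y. sinh (k * y)) has_real_derivative k * cosh (k * y)) (at y)"
        by (auto intro!: derivative_eq_intros)
      show "(?U has_vector_derivative ?U1 y) (at y)"
        by (rule has_vector_derivative_add[OF vd[OF d(1)] vd[OF d(2)]])
      have "(?U1 has_vector_derivative (k * (k * cosh (k * y))) *\<^sub>R ?e 1
          + (k * (k * sinh (k * y))) *\<^sub>R ?e 2) (at y)"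
        by (rule has_vector_derivative_add[OF vd[OF DERIV_cmult[OF d(2)]] vd[OF DERIV_cmult[OF d(1)]]])
      moreover have "k * (k * z) = C * z" for z
        using k(2) by (simp add: mult.assoc[symmetric])
      ultimately show "(?U1 has_vector_derivative C *\<^sub>R ?U y) (at y)"
        by (simp only: scaleR_add_right scaleR_scaleR)
      show "?U y $ 1 * ?U1 y $ 2 - ?U y $ 2 * ?U1 y $ 1 = k"
        using hyperbolic_pythagoras[of "k * y"]
        by (simp add: axis_def power2_eq_square algebra_simps flip: right_diff_distrib)
      show "?U y $ 3 = 0" "?U1 y $ 3 = 0" by (simp_all add: axis_def)
    next
      fix c
      show "conic_slices (\<lambda>t. m (Re t) *\<^sub>R ?U (Im t) + c (Re t))"
        unfolding conic_slices_def slice[of ?U c] using is_hyperbola_branch_slice[OF m_pos less_imp_neq[OF k(1), symmetric]] by blast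
    qed (use 2 k in simp_all)
  next
    case 3
    have ab: "2 * exp (w x) = a x * b x" if "x \<in> I" for x
      using C[OF that] 3 by simp
    have "continuous_on I (\<lambda>x. ((a x - b x) / 2)\<^sup>2)"
      using cont by (rule continuous_on_power)
    from antiderivative_on_open_interval[OF open_I interval_I nonempty_I this]
    obtain Q where dQ: "\<And>x. x \<in> I \<Longrightarrow> (Q has_real_derivative ((a x - b x) / 2)\<^sup>2) (at x)" by blast
    \<comment> \<open>The equation \<open>f\<^sub>y\<^sub>y = 2 e\<^sup>w f - b f\<^sub>x\<close> requires a solution \<open>k\<close> of \<open>m = 2 e\<^sup>w k - b k'\<close>. With \<open>k = m s\<close>
      and \<open>2 e\<^sup>w = a b\<close> it reduces to \<open>s' = - 1 / b = - a e\<^sup>-\<^sup>w / 2\<close>, and \<open>Q\<close> is an antiderivative of \<open>e\<^sup>-\<^sup>2\<^sup>w\<close>.\<close>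
    define s where "s x = (a x - b x) / 8 - Q x / 2" for x
    define k where "k x = m x * s x" for x
    define k1 where "k1 x = a x * k x - m x * (a x * (a x - b x) / 4)" for x
    have ds: "(s has_real_derivative - (a x * (a x - b x) / 4)) (at x)" if "x \<in> I" for x
      unfolding s_def[abs_def]
      by (rule DERIV_cong[OF DERIV_diff[OF DERIV_cdivide[OF DERIV_diff[OF da[OF that] db[OF that]]]
              DERIV_cdivide[OF dQ[OF that]]]])
        (simp add: field_simps power2_eq_square)
    have dk: "(k has_real_derivative k1 x) (at x)" if "x \<in> I" for x
      unfolding k_def[abs_def] k1_def
      by (rule DERIV_cong[OF DERIV_mult[OF dm[OF that] ds[OF that]]]) (simp add: k_def algebra_simps)
    have dk1: "(k1 has_real_derivative b x * k1 x + 2 * exp (w x) * k x) (at x)" if "x \<in> I" for x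
      unfolding k1_def[abs_def]
      by (rule DERIV_cong[OF DERIV_diff[OF DERIV_mult[OF da[OF that] dk[OF that]]
              DERIV_mult[OF dm[OF that] DERIV_cdivide[OF DERIV_mult[OF da[OF that]
                DERIV_diff[OF da[OF that] db[OF that]]]]]]])
        (simp add: k1_def ab[OF that] field_simps power2_eq_square)
    have mk: "m x = 2 * exp (w x) * k x - b x * k1 x" if "x \<in> I" for x
    proof -
      have "a x - b x = 2 * exp (- w x)"
        using exp_w_ab[of x] by simp
      then have "a x * b x * (a x - b x) = 4 * (exp (w x) * exp (- w x))"
        using ab[OF that] by simp
      also have "exp (w x) * exp (- w x) = 1"
        by (simp flip: exp_add)
      finally have "a x * b x * (a x - b x) = 4" by simp
      then have "m x * (a x * b x * (a x - b x)) = m x * 4" by simp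
      then show ?thesis
        using ab[OF that] by (simp add: k1_def algebra_simps)
    qed
    let ?U = "\<lambda>y. (y\<^sup>2 / 2) *\<^sub>R ?e 1 + y *\<^sub>R ?e 2"
    let ?U1 = "\<lambda>y. y *\<^sub>R ?e 1 + 1 *\<^sub>R ?e 2"
    \<comment> \<open>The factor \<open>2\<close> in the third component normalizes the determinant.\<close>
    let ?K = "\<lambda>x. k x *\<^sub>R ?e 1 + (2 * n x) *\<^sub>R ?e 3"
    let ?K1 = "\<lambda>x. k1 x *\<^sub>R ?e 1 + (2 * n1 x) *\<^sub>R ?e 3"
    have mf: "moving_frame (\<lambda>t. m (Re t) *\<^sub>R ?U (Im t) + ?K (Re t))
      (\<lambda>t. (a (Re t) * m (Re t)) *\<^sub>R ?U (Im t) + ?K1 (Re t)) (\<lambda>t. m (Re t) *\<^sub>R ?U1 (Im t))"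
    proof (rule moving_frame_separated[OF C dm, where Z = "?e 1"])
      fix y
      show "(?U has_vector_derivative ?U1 y) (at y)"
        by (intro has_vector_derivative_add vd) (auto intro!: derivative_eq_intros)
      have "(?U1 has_vector_derivative 1 *\<^sub>R ?e 1 + 0 *\<^sub>R ?e 2) (at y)"
        by (intro has_vector_derivative_add vd) (auto intro!: derivative_eq_intros)
      then show "(?U1 has_vector_derivative C *\<^sub>R ?U y + ?e 1) (at y)" by (simp add: 3)
    next
      fix x assume x: "x \<in> I"
      show "(?K has_vector_derivative ?K1 x) (at x)"
        by (intro has_vector_derivative_add vd dk[OF x] DERIV_cmult[OF dn[OF x]])
      have "(?K1 has_vector_derivative (b x * k1 x + 2 * exp (w x) * k x) *\<^sub>R ?e 1 +
          (2 * (b x * n1 x + 2 * exp (w x) * n x)) *\<^sub>R ?e 3) (at x)"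
        by (intro has_vector_derivative_add vd dk1[OF x] DERIV_cmult[OF dn1[OF x]])
      then show "(?K1 has_vector_derivative b x *\<^sub>R ?K1 x + (2 * exp (w x)) *\<^sub>R ?K x) (at x)"
        by (simp add: algebra_simps)
      have "(2 * exp (w x)) *\<^sub>R ?K x - b x *\<^sub>R ?K1 x = (2 * exp (w x) * k x - b x * k1 x) *\<^sub>R ?e 1"
        by (simp add: n_def n1_def algebra_simps)
      then show "m x *\<^sub>R ?e 1 = (2 * exp (w x)) *\<^sub>R ?K x - b x *\<^sub>R ?K1 x"
        using mk[OF x] by simp
    qed
    have "gives_rise_to S (\<lambda>t. w (Re t)) (\<lambda>t. m (Re t) *\<^sub>R ?U (Im t) + ?K (Re t))"
    proof (rule gives_rise_to_of_moving_frame[OF mf])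
      fix t assume "t \<in> S"
      then have x: "Re t \<in> I" by (simp add: strip_def)
      let ?x = "Re t" and ?y = "Im t"
      have "det (vector [(a ?x * m ?x) *\<^sub>R ?U ?y + ?K1 ?x, m ?x *\<^sub>R ?U1 ?y, m ?x *\<^sub>R ?U ?y + ?K ?x] :: real^3^3)
        = 2 * m ?x * (n ?x * k1 ?x - n1 ?x * k ?x + (n1 ?x - a ?x * n ?x) * (m ?x * ?y\<^sup>2 / 2))"
        by (simp add: det_3 vector_3 axis_def power2_eq_square field_simps)
      also have "n1 ?x - a ?x * n ?x = 0"
        using ab[OF x] by (simp add: n_def n1_def)
      also have "n ?x * k1 ?x - n1 ?x * k ?x = - (q ?x * m ?x)"
        unfolding mk[OF x] by (simp add: n_def n1_def algebra_simps)
      also have "2 * m ?x * (- (q ?x * m ?x) + 0 * (m ?x * ?y\<^sup>2 / 2)) = - (2 * ((m ?x)\<^sup>2 * q ?x))"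
        by (simp add: power2_eq_square)
      finally show "\<bar>det (vector [(a ?x * m ?x) *\<^sub>R ?U ?y + ?K1 ?x, m ?x *\<^sub>R ?U1 ?y, m ?x *\<^sub>R ?U ?y + ?K ?x] :: real^3^3)\<bar>
        = 2 * exp (w ?x)"
        by (simp add: m2q)
    qed
    moreover have "conic_slices (\<lambda>t. m (Re t) *\<^sub>R ?U (Im t) + ?K (Re t))"
      unfolding conic_slices_def slice[of ?U ?K] using is_parabola_slice[OF m_pos] by blast
    ultimately show ?thesis by blast
  qed
qed

lemma gives_rise_to_uminus:
  assumes "gives_rise_to S (\<lambda>t. w (Re t)) g"
  shows "gives_rise_to S (\<lambda>t. w (Re t)) (\<lambda>t. - g t)"
proof (rule gives_rise_to_of_moving_frame)
  show "moving_frame (\<lambda>t. - g t) (\<lambda>t. - dirder 1 g t) (\<lambda>t. - dirder \<i> g t)"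
    by (rule moving_frame_linear[OF bounded_linear_minus[OF bounded_linear_ident]
          moving_frame_of_gives_rise_to(1)[OF assms]])
  fix t assume t: "t \<in> S"
  have "det (vector [- dirder 1 g t, - dirder \<i> g t, - g t] :: real^3^3)
      = - det (vector [dirder 1 g t, dirder \<i> g t, g t] :: real^3^3)"
    by (simp add: det_3 vector_3)
  then show "\<bar>det (vector [- dirder 1 g t, - dirder \<i> g t, - g t] :: real^3^3)\<bar> = 2 * exp (w (Re t))"
    using moving_frame_of_gives_rise_to(2)[OF assms t] by simp
qed

lemma conic_slices_uminus: "conic_slices g \<Longrightarrow> conic_slices (\<lambda>t. - g t)"
proof -
  have "slice_curve (\<lambda>t. - g t) x = uminus ` slice_curve g x" for x
    by (auto simp: slice_curve_def)
  then show "conic_slices g \<Longrightarrow> conic_slices (\<lambda>t. - g t)"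
    unfolding conic_slices_def by (auto intro: conic_uminus)
qed

lemma gives_rise_to_equiaffine_conic_slices:
  assumes f: "gives_rise_to S (\<lambda>t. w (Re t)) f"
  shows "\<exists>g. equiaffinely_equivalent S f g \<and> gives_rise_to S (\<lambda>t. w (Re t)) g \<and> conic_slices g"
proof -
  obtain g where g: "gives_rise_to S (\<lambda>t. w (Re t)) g" "conic_slices g"
    using conic_model by blast
  from gives_rise_to_unique[OF f g(1)] show ?thesis
  proof
    assume "equiaffinely_equivalent S f g"
    with g show ?thesis by blast
  next
    assume "equiaffinely_equivalent S f (\<lambda>t. - g t)"
    with gives_rise_to_uminus[OF g(1)] conic_slices_uminus[OF g(2)] show ?thesis by blast
  qed
qed

end

theorem corollary4p11:
  fixes I :: "real set" and w :: "real \<Rightarrow> real"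
  assumes "open I" and "is_interval I" and "I \<noteq> {}"
    and "tzitzeica_solution (strip I) (\<lambda>t. w (Re t))"
  shows "(\<exists>f. gives_rise_to (strip I) (\<lambda>t. w (Re t)) f) \<and>
    (\<forall>f g. gives_rise_to (strip I) (\<lambda>t. w (Re t)) f \<longrightarrow>
           gives_rise_to (strip I) (\<lambda>t. w (Re t)) g \<longrightarrow>
           equiaffinely_equivalent (strip I) f g \<or>
           equiaffinely_equivalent (strip I) f (\<lambda>t. - g t)) \<and>
    (\<forall>f. gives_rise_to (strip I) (\<lambda>t. w (Re t)) f \<longrightarrow>
       hyperbolic_affine_sphere (strip I) f \<and>
       (\<exists>g. equiaffinely_equivalent (strip I) f g \<and>
            hyperbolic_affine_sphere (strip I) g \<and>
            ((\<forall>x\<in>I. is_circle (slice_curve g x)) \<or>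
             (\<forall>x\<in>I. is_hyperbola_branch (slice_curve g x)) \<or>
             (\<forall>x\<in>I. is_parabola (slice_curve g x)))))"
proof -
  obtain w1 where "\<And>x. x \<in> I \<Longrightarrow> (w has_real_derivative w1 x) (at x)"
    "\<And>x. x \<in> I \<Longrightarrow> (w1 has_real_derivative 4 * (exp (w x) - exp (- 2 * w x))) (at x)"
    using tzitzeica_profile_ode[OF assms(1,4)] by blast
  then interpret tzitzeica_profile I w w1
    using assms by unfold_locales auto
  have has: "hyperbolic_affine_sphere S f" if "gives_rise_to S (\<lambda>t. w (Re t)) f" for f
    using that unfolding gives_rise_to_def hyperbolic_affine_sphere_def by blast
  show ?thesis
  proof (intro conjI allI impI)
    show "\<exists>f. gives_rise_to S (\<lambda>t. w (Re t)) f" using conic_model by blast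
  next
    fix f g assume "gives_rise_to S (\<lambda>t. w (Re t)) f" "gives_rise_to S (\<lambda>t. w (Re t)) g"
    then show "equiaffinely_equivalent S f g \<or> equiaffinely_equivalent S f (\<lambda>t. - g t)"
      by (rule gives_rise_to_unique)
  next
    fix f assume f: "gives_rise_to S (\<lambda>t. w (Re t)) f"
    show "hyperbolic_affine_sphere S f" by (rule has[OF f])
    obtain g where g: "equiaffinely_equivalent S f g" "gives_rise_to S (\<lambda>t. w (Re t)) g" "conic_slices g"
      using gives_rise_to_equiaffine_conic_slices[OF f] by blast
    show "\<exists>g. equiaffinely_equivalent S f g \<and> hyperbolic_affine_sphere S g \<and>
            ((\<forall>x\<in>I. is_circle (slice_curve g x)) \<or>
             (\<forall>x\<in>I. is_hyperbola_branch (slice_curve g x)) \<or>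
             (\<forall>x\<in>I. is_parabola (slice_curve g x)))"
      using g(1) has[OF g(2)] g(3)[unfolded conic_slices_def] by blast
  qed
qed

end
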